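(* Let $n\ge 1$, let $f\colon\mathbb{D}\to\mathbb{D}$ be holomorphic and let $z_1,\ldots,z_n\in\mathbb{D}$; write $Z=(z_1,\ldots,z_n)$. Define the $n\times n$ matrices $$G_Z=\left[\frac{1}{(1-z_i\overline{z_j})^2}\right]_{i,j=1}^n,\qquad H_{f,Z}=\left[\frac{f'(z_i)\overline{f'(z_j)}}{(1-f(z_i)\overline{f(z_j)})^2}\right]_{i,j=1}^n.$$ Then $$H_{f,Z}\le n\,G_Z .$$ If $f=B$ is a finite Blaschke product of degree $d\geq 1$, then $$H_{B,Z}\le \min\{n,d\}\,G_Z .$$ Both constants are sharp: for each $n\ge 1$, there is no real constant $C<n$ such that $H_{f,Z}\le C\,G_Z$ for all holomorphic $f\colon\mathbb{D}\to\mathbb{D}$ and all $Z\in\mathbb{D}^n$; and for each $n,d\ge 1$, there is no real constant $C<\min\{n,d\}$ such that $H_{B,Z}\le C\,G_Z$ for all finite Blaschke products $B$ of degree $d$ and all $Z\in\mathbb{D}^n$.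
   Context: $\mathbb{D}$ is the open unit disk in $\mathbb{C}$. For Hermitian matrices, $A\le B$ is the Loewner order: $B-A$ is positive semidefinite. A finite Blaschke product of degree $d$ is a function $B(z)=e^{i\theta}\prod_{k=1}^d\frac{z-a_k}{1-\overline{a_k}z}$ with $\theta\in\mathbb{R}$ and $a_1,\ldots,a_d\in\mathbb{D}$ (repetitions allowed). The points $z_1,\ldots,z_n$ are not assumed distinct. *)

theory Defs
  imports
    "HOL-Complex_Analysis.Complex_Analysis"
    "Jordan_Normal_Form.Schur_Decomposition"
begin

abbreviation unit_disc :: "complex set" where
  "unit_disc \<equiv> ball 0 1"

definition hermitian_mat :: "complex mat \<Rightarrow> bool" where
  "hermitian_mat A \<longleftrightarrow> square_mat A \<and> mat_adjoint A = A"

(* The order on complex numbers is that of Complex_Order: 0 \<le> w says that w is real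
   and nonnegative. The form (A v) \<bullet>c v is v* A v, since \<bullet>c conjugates its
   second argument. *)
definition psd_mat :: "complex mat \<Rightarrow> bool" where
  "psd_mat A \<longleftrightarrow> hermitian_mat A \<and>
     (\<forall>v \<in> carrier_vec (dim_row A). 0 \<le> (A *\<^sub>v v) \<bullet>c v)"

(* Subtraction of mat takes its dimensions from the second argument, so equality of
   the sizes has to be required explicitly. *)
definition loewner_le :: "complex mat \<Rightarrow> complex mat \<Rightarrow> bool" (infix "\<le>\<^sub>L" 50) where
  "A \<le>\<^sub>L B \<longleftrightarrow> hermitian_mat A \<and> hermitian_mat B \<and> dim_row A = dim_row B \<and> psd_mat (B - A)"

(* Points z_1, ..., z_n are represented by Z 0, ..., Z (n - 1). *)
definition G_mat :: "nat \<Rightarrow> (nat \<Rightarrow> complex) \<Rightarrow> complex mat" where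
  "G_mat n Z = mat n n (\<lambda>(i, j). 1 / (1 - Z i * cnj (Z j))\<^sup>2)"

definition H_mat :: "nat \<Rightarrow> (complex \<Rightarrow> complex) \<Rightarrow> (nat \<Rightarrow> complex) \<Rightarrow> complex mat" where
  "H_mat n f Z = mat n n (\<lambda>(i, j).
     deriv f (Z i) * cnj (deriv f (Z j)) / (1 - f (Z i) * cnj (f (Z j)))\<^sup>2)"

(* Functions on the disc are total functions whose values outside the disc are irrelevant,
   hence the formula is only required on the disc. *)
definition finite_blaschke :: "nat \<Rightarrow> (complex \<Rightarrow> complex) \<Rightarrow> bool" where
  "finite_blaschke d B \<longleftrightarrow>
     (\<exists>(\<theta>::real) (a :: nat \<Rightarrow> complex). (\<forall>k<d. a k \<in> unit_disc) \<and>
        (\<forall>z \<in> unit_disc. B z = exp (\<i> * of_real \<theta>) * (\<Prod>k<d. (z - a k) / (1 - cnj (a k) * z))))"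

end

theory Submission
  imports Defs
begin

text \<open>
  Write P for the Pick kernel (1 - f z * cnj (f w)) / (1 - z * cnj w). By the Schur product theorem
  it suffices to show that the rank one matrix f'(z_i) * cnj (f'(z_j)) is at most m * P(z_i, z_j)^2.

  For a Blaschke product of degree d the kernel P is a sum of d squares in two ways, with bases
  e_k and g_k of the model space such that f' is the sum of e_k * g_k; the Cauchy-Schwarz
  inequality then gives m = d.

  For a general f the matrix P(z_i, z_j) and its transpose are the diagonal blocks of a positive
  semidefinite matrix whose off-diagonal block consists of the divided differences of f, so that
  f'(z_i) is on the diagonal of that block. Testing this with a P-orthonormal basis of C^n gives m = n,
  the trace of the Gram matrix of the basis.
\<close>

section \<open>Means over the unit circle\<close>

text \<open>The block positivity rests on multiplication by f being a contraction of L^2 of the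
  circle that maps the Hardy space into itself. Szego kernels lie in the Hardy space, Cauchy kernels
  \<open>1 / (u - w)\<close> in its orthogonal complement, and the Hardy part of
  \<open>f u / (u - w)\<close> is the divided difference of f at u and w. This needs f on the closed
  disc, hence the dilations \<open>f (r * z)\<close>; an orthonormal basis needs a definite matrix,
  hence a perturbation by \<epsilon>. Both are removed by limits. The bound n does not follow from
  the one for Blaschke products by interpolation: f and f' would have to be matched at n points,
  which may take degree 2n.\<close>

definition circle_mean :: "(complex \<Rightarrow> complex) \<Rightarrow> complex \<Rightarrow> bool" where
  "circle_mean g I \<longleftrightarrow> ((\<lambda>t. g (cis (2 * pi * t))) has_integral I) {0..1}"

lemma circle_mean_cong:
  assumes "circle_mean g I" "\<And>u. norm u = 1 \<Longrightarrow> g u = h u"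
  shows "circle_mean h I"
proof -
  have "(\<lambda>t. g (cis (2 * pi * t))) = (\<lambda>t. h (cis (2 * pi * t)))"
    by (auto simp: assms(2))
  then show ?thesis
    using assms(1) by (simp add: circle_mean_def)
qed

lemma circle_mean_add:
  "circle_mean g I \<Longrightarrow> circle_mean h J \<Longrightarrow> circle_mean (\<lambda>u. g u + h u) (I + J)"
  unfolding circle_mean_def by (rule has_integral_add)

lemma circle_mean_mult_left:
  "circle_mean g I \<Longrightarrow> circle_mean (\<lambda>u. c * g u) (c * I)"
  unfolding circle_mean_def by (rule has_integral_mult_right)

lemma circle_mean_sum:
  "finite A \<Longrightarrow> (\<And>i. i \<in> A \<Longrightarrow> circle_mean (g i) (I i)) \<Longrightarrow>
    circle_mean (\<lambda>u. \<Sum>i\<in>A. g i u) (\<Sum>i\<in>A. I i)"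
  unfolding circle_mean_def by (rule has_integral_sum)

lemma circle_mean_Re_nonneg:
  assumes "circle_mean g I" "\<And>u. norm u = 1 \<Longrightarrow> 0 \<le> Re (g u)"
  shows "0 \<le> Re I"
proof -
  have "((\<lambda>t. Re (g (cis (2 * pi * t)))) has_integral Re I) {0..1}"
    using assms(1) unfolding circle_mean_def by (rule has_integral_Re)
  then show ?thesis
    by (rule has_integral_nonneg) (simp add: assms(2))
qed

lemma circle_mean_contour:
  assumes "(h has_contour_integral (2 * of_real pi * \<i> * I)) (circlepath 0 1)"
    "\<And>u. norm u = 1 \<Longrightarrow> g u = u * h u"
  shows "circle_mean g I"
proof -
  have "((\<lambda>x. h (circlepath 0 1 x) * vector_derivative (circlepath 0 1) (at x))
      has_integral (2 * of_real pi * \<i> * I)) {0..1}"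
    using assms(1) by (simp add: has_contour_integral)
  then have "((\<lambda>x. (1 / (2 * of_real pi * \<i>)) *
        (h (circlepath 0 1 x) * vector_derivative (circlepath 0 1) (at x)))
      has_integral ((1 / (2 * of_real pi * \<i>)) * (2 * of_real pi * \<i> * I))) {0..1}"
    by (rule has_integral_mult_right)
  moreover have "(1 / (2 * of_real pi * \<i>)) *
        (h (circlepath 0 1 x) * vector_derivative (circlepath 0 1) (at x)) =
      g (cis (2 * pi * x))" for x
    unfolding vector_derivative_circlepath
    by (simp add: assms(2) circlepath cis_conv_exp mult_ac)
  ultimately show ?thesis
    by (simp add: circle_mean_def)
qed

section \<open>Hardy space pairings of Szego and Cauchy kernels\<close>

definition szego :: "complex \<Rightarrow> complex \<Rightarrow> complex" where
  "szego w u = 1 / (1 - cnj w * u)"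

definition divided_diff :: "(complex \<Rightarrow> complex) \<Rightarrow> complex \<Rightarrow> complex \<Rightarrow> complex" where
  "divided_diff f z w = (if z = w then deriv f z else (f z - f w) / (z - w))"

lemma szego_denominator:
  assumes "norm w < 1" "norm u \<le> 1"
  shows "1 - cnj w * u \<noteq> 0"
proof
  assume "1 - cnj w * u = 0"
  then have "norm w * norm u = 1"
    by (metis complex_mod_cnj eq_iff_diff_eq_0 norm_mult norm_one)
  moreover have "norm w * norm u \<le> norm w"
    using assms by (simp add: mult_left_le)
  ultimately show False
    using assms by simp
qed

text \<open>On the circle \<open>cnj u\<close> is \<open>1 / u\<close>, so a conjugated kernel is
  the restriction of a rational function of u. This rule and the next bring the integrands below
  within reach of Cauchy's theorem.\<close>

lemma cnj_szego_circle:
  assumes "norm z < 1" "norm u = 1"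
  shows "cnj (szego z u) = u / (u - z)"
proof -
  have "u * cnj u = 1"
    using assms(2) by (simp flip: complex_norm_square)
  then have "u * (1 - z * cnj u) = u - z"
    by (simp add: right_diff_distrib mult.left_commute[of u z])
  moreover have "u - z \<noteq> 0"
    using assms by auto
  ultimately have "1 / (1 - z * cnj u) = u / (u - z)"
    by (metis mult_zero_right nonzero_divide_mult_cancel_left mult_eq_0_iff)
  then show ?thesis
    by (simp add: szego_def)
qed

lemma cnj_cauchy_circle:
  assumes "norm z < 1" "norm u = 1"
  shows "cnj (1 / (u - z)) = u * szego z u"
proof -
  have "cnj u * u = 1"
    using assms(2) by (simp add: mult.commute flip: complex_norm_square)
  then have "cnj (u * szego z u) = 1 / (u - z)"
    unfolding complex_cnj_mult cnj_szego_circle[OF assms] times_divide_eq_right by simp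
  then show ?thesis
    by (metis complex_cnj_cnj)
qed

context
  fixes f :: "complex \<Rightarrow> complex"
  assumes f: "f holomorphic_on cball 0 1"
begin

text \<open>Reproducing property of the Szego kernel: its conjugate supplies a simple pole at z, and
  the other factors are holomorphic on the closed disc.\<close>

lemma circle_mean_szego_szego:
  assumes "norm z < 1" "norm w < 1"
  shows "circle_mean (\<lambda>u. f u * szego w u * cnj (szego z u)) (f z * szego w z)"
proof (rule circle_mean_contour)
  show "((\<lambda>u. (f u * szego w u) / (u - z)) has_contour_integral
      (2 * of_real pi * \<i> * (f z * szego w z))) (circlepath 0 1)"
    unfolding szego_def
    by (intro Cauchy_integral_circlepath_simple holomorphic_intros f)
      (use assms szego_denominator in auto)
  show "f u * szego w u * cnj (szego z u) = u * (f u * szego w u / (u - z))" if "norm u = 1" for u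
    using that assms by (simp only: cnj_szego_circle cnj_cauchy_circle) (simp add: mult_ac)
qed

text \<open>Here the pole is at w. For f = 1 the value shows that the Gram matrix of the Cauchy
  kernels is the transpose of that of the Szego kernels, which is why the second diagonal block is
  the transposed Pick matrix.\<close>

lemma circle_mean_cauchy_cauchy:
  assumes "norm z < 1" "norm w < 1"
  shows "circle_mean (\<lambda>u. f u * (1 / (u - w)) * cnj (1 / (u - z))) (f w * szego z w)"
proof (rule circle_mean_contour)
  show "((\<lambda>u. (f u * szego z u) / (u - w)) has_contour_integral
      (2 * of_real pi * \<i> * (f w * szego z w))) (circlepath 0 1)"
    unfolding szego_def
    by (intro Cauchy_integral_circlepath_simple holomorphic_intros f)
      (use assms szego_denominator in auto)
  show "f u * (1 / (u - w)) * cnj (1 / (u - z)) = u * (f u * szego z u / (u - w))" if "norm u = 1" for u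
    using that assms by (simp only: cnj_szego_circle cnj_cauchy_circle) (simp add: mult_ac)
qed

text \<open>No pole is left in the disc: the Cauchy kernels are orthogonal to the Hardy
  space.\<close>

lemma circle_mean_szego_cauchy:
  assumes "norm z < 1" "norm w < 1"
  shows "circle_mean (\<lambda>u. f u * szego w u * cnj (1 / (u - z))) 0"
proof (rule circle_mean_contour)
  have "((\<lambda>u. f u * szego w u * szego z u) has_contour_integral 0) (circlepath 0 1)"
    unfolding szego_def
    by (rule Cauchy_theorem_convex_simple[of _ "cball 0 1"]; (intro holomorphic_intros f)?)
      (use assms szego_denominator in auto)
  then show "((\<lambda>u. f u * szego w u * szego z u) has_contour_integral
      (2 * of_real pi * \<i> * 0)) (circlepath 0 1)"
    by simp
  show "f u * szego w u * cnj (1 / (u - z)) = u * (f u * szego w u * szego z u)" if "norm u = 1" for u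
    using that assms by (simp only: cnj_szego_circle cnj_cauchy_circle) (simp add: mult_ac)
qed

text \<open>The residues at the two poles z and w add up to the divided difference. If the points
  coincide, the double pole yields the derivative; this is how f' enters the diagonal of the
  block.\<close>

lemma circle_mean_cauchy_szego:
  assumes "norm z < 1" "norm w < 1"
  shows "circle_mean (\<lambda>u. f u * (1 / (u - w)) * cnj (szego z u)) (divided_diff f z w)"
proof (rule circle_mean_contour)
  show "((\<lambda>u. f u / ((u - z) * (u - w))) has_contour_integral
      (2 * of_real pi * \<i> * divided_diff f z w)) (circlepath 0 1)"
  proof (cases "z = w")
    case True
    have f': "continuous_on (cball 0 1) f" "f holomorphic_on ball 0 1"
      using f holomorphic_on_imp_continuous_on holomorphic_on_subset by fastforce+
    show ?thesis
      using Cauchy_derivative_integral_circlepath[OF f', of z] assms True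
        has_contour_integral_integral[of "\<lambda>u. f u / (u - z)^2"]
      by (auto dest!: DERIV_imp_deriv simp: divided_diff_def power2_eq_square)
  next
    case False
    have "((\<lambda>u. (1 / (z - w)) * (f u / (u - z) - f u / (u - w))) has_contour_integral
        (1 / (z - w)) * (2 * of_real pi * \<i> * f z - 2 * of_real pi * \<i> * f w)) (circlepath 0 1)"
      by (intro has_contour_integral_lmul has_contour_integral_diff
          Cauchy_integral_circlepath_simple f) (use assms in auto)
    moreover have "(1 / (z - w)) * (2 * of_real pi * \<i> * f z - 2 * of_real pi * \<i> * f w) =
        2 * of_real pi * \<i> * divided_diff f z w"
      using False by (simp add: divided_diff_def field_simps)
    ultimately have *: "((\<lambda>u. (1 / (z - w)) * (f u / (u - z) - f u / (u - w))) has_contour_integral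
        (2 * of_real pi * \<i> * divided_diff f z w)) (circlepath 0 1)"
      by simp
    show ?thesis
    proof (rule has_contour_integral_eq[OF *])
      fix u assume "u \<in> path_image (circlepath 0 1 :: real \<Rightarrow> complex)"
      then have "u \<noteq> z" "u \<noteq> w" using assms by auto
      then have "u - z \<noteq> 0" "u - w \<noteq> 0" "z - w \<noteq> 0" using False by auto
      then have "f u / (u - z) - f u / (u - w) = f u * (z - w) / ((u - z) * (u - w))"
        by (simp add: diff_frac_eq) (simp add: algebra_simps)
      then show "(1 / (z - w)) * (f u / (u - z) - f u / (u - w)) = f u / ((u - z) * (u - w))"
        using \<open>z - w \<noteq> 0\<close> by simp
    qed
  qed
  show "f u * (1 / (u - w)) * cnj (szego z u) = u * (f u / ((u - z) * (u - w)))" if "norm u = 1" for u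
    using that assms by (simp only: cnj_szego_circle cnj_cauchy_circle) (simp add: mult_ac)
qed

end

section \<open>The Pick kernel and the divided differences\<close>

definition pick_kernel :: "(complex \<Rightarrow> complex) \<Rightarrow> complex \<Rightarrow> complex \<Rightarrow> complex" where
  "pick_kernel f z w = (1 - f z * cnj (f w)) / (1 - z * cnj w)"

text \<open>The integrand has, in its first component, the Hardy part \<open>x * szego\<close> and,
  in its second, the complementary part \<open>y / (u - w)\<close>. The two remaining parts are
  those that minimise the form: minus the projections of \<open>f u * y / (u - w)\<close> and of
  \<open>cnj (f u) * x * szego w u\<close>. Both kernels are eigenvectors of these compressions,
  with eigenvalues \<open>f w\<close> and \<open>cnj (f w)\<close>. The factor 2 stands for both
  off-diagonal blocks, as only the real part of the sum will matter.\<close>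

lemma pick_block_term:
  fixes z w x\<^sub>1 x\<^sub>2 y\<^sub>1 y\<^sub>2 :: complex
  assumes f: "f holomorphic_on cball 0 1" and zw: "norm z < 1" "norm w < 1"
  shows "circle_mean (\<lambda>u.
      (x\<^sub>2 * szego w u - y\<^sub>2 * f w * (1 / (u - w))) * cnj (x\<^sub>1 * szego z u - y\<^sub>1 * f z * (1 / (u - z)))
    + (y\<^sub>2 * (1 / (u - w)) - x\<^sub>2 * cnj (f w) * szego w u) *
        cnj (y\<^sub>1 * (1 / (u - z)) - x\<^sub>1 * cnj (f z) * szego z u)
    + 2 * (f u * (y\<^sub>2 * (1 / (u - w)) - x\<^sub>2 * cnj (f w) * szego w u) *
        cnj (x\<^sub>1 * szego z u - y\<^sub>1 * f z * (1 / (u - z)))))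
    (cnj x\<^sub>1 * pick_kernel f z w * x\<^sub>2 + cnj y\<^sub>1 * pick_kernel f w z * y\<^sub>2
      + 2 * (cnj x\<^sub>1 * divided_diff f z w * y\<^sub>2))"
proof -
  have 1: "(\<lambda>u. 1) holomorphic_on cball (0::complex) 1" by simp
  note f_means = circle_mean_szego_szego[OF f zw] circle_mean_cauchy_cauchy[OF f zw]
    circle_mean_szego_cauchy[OF f zw] circle_mean_cauchy_szego[OF f zw]
  note one_means = circle_mean_szego_szego[OF 1 zw] circle_mean_cauchy_cauchy[OF 1 zw]
    circle_mean_szego_cauchy[OF 1 zw] circle_mean_cauchy_szego[OF 1 zw]
  \<comment> \<open>Coefficients of the eight kernel pairings, four with weight 1 and four with
    weight f. Together \<open>?s\<close> and \<open>?c\<close> give 1 + f z * cnj (f w) - 2 * f z *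
    cnj (f w), the numerator of the Pick kernel; \<open>?t\<close> and \<open>?d\<close> do the same
    for its transpose. The pairings at \<open>?a\<close>, \<open>?b\<close> and \<open>?e\<close>
    vanish.\<close>
  let ?s = "x\<^sub>2 * cnj x\<^sub>1 * (1 + cnj (f w) * f z)"
  let ?t = "y\<^sub>2 * cnj y\<^sub>1 * (1 + f w * cnj (f z))"
  let ?a = "- x\<^sub>2 * cnj y\<^sub>1 * (cnj (f z) + cnj (f w))"
  let ?b = "- y\<^sub>2 * cnj x\<^sub>1 * (f w + f z)"
  let ?c = "- 2 * x\<^sub>2 * cnj x\<^sub>1 * cnj (f w)"
  let ?d = "- 2 * y\<^sub>2 * cnj y\<^sub>1 * cnj (f z)"
  let ?e = "2 * x\<^sub>2 * cnj y\<^sub>1 * cnj (f w) * cnj (f z)"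
  let ?g = "2 * y\<^sub>2 * cnj x\<^sub>1"
  note mean = circle_mean_add[OF circle_mean_add[OF circle_mean_add[OF circle_mean_add[OF
      circle_mean_add[OF circle_mean_add[OF circle_mean_add[OF
      circle_mean_mult_left[OF one_means(1), of ?s] circle_mean_mult_left[OF one_means(2), of ?t]]
      circle_mean_mult_left[OF one_means(3), of ?a]] circle_mean_mult_left[OF one_means(4), of ?b]]
      circle_mean_mult_left[OF f_means(1), of ?c]] circle_mean_mult_left[OF f_means(2), of ?d]]
      circle_mean_mult_left[OF f_means(3), of ?e]] circle_mean_mult_left[OF f_means(4), of ?g]]
  have "circle_mean (\<lambda>u.
      (x\<^sub>2 * szego w u - y\<^sub>2 * f w * (1 / (u - w))) * cnj (x\<^sub>1 * szego z u - y\<^sub>1 * f z * (1 / (u - z)))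
    + (y\<^sub>2 * (1 / (u - w)) - x\<^sub>2 * cnj (f w) * szego w u) *
        cnj (y\<^sub>1 * (1 / (u - z)) - x\<^sub>1 * cnj (f z) * szego z u)
    + 2 * (f u * (y\<^sub>2 * (1 / (u - w)) - x\<^sub>2 * cnj (f w) * szego w u) *
        cnj (x\<^sub>1 * szego z u - y\<^sub>1 * f z * (1 / (u - z)))))
    (?s * (1 * szego w z) + ?t * (1 * szego z w) + ?a * 0 + ?b * divided_diff (\<lambda>u. 1) z w
      + ?c * (f z * szego w z) + ?d * (f w * szego z w) + ?e * 0 + ?g * divided_diff f z w)"
    by (rule circle_mean_cong[OF mean]) (simp add: algebra_simps add_divide_distrib)
  moreover have "?s * (1 * szego w z) + ?t * (1 * szego z w) + ?a * 0
      + ?b * divided_diff (\<lambda>u. 1) z w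
      + ?c * (f z * szego w z) + ?d * (f w * szego z w) + ?e * 0 + ?g * divided_diff f z w =
    cnj x\<^sub>1 * pick_kernel f z w * x\<^sub>2 + cnj y\<^sub>1 * pick_kernel f w z * y\<^sub>2
      + 2 * (cnj x\<^sub>1 * divided_diff f z w * y\<^sub>2)"
  proof -
    have eqs: "pick_kernel f z w = (1 - f z * cnj (f w)) * szego w z"
      "pick_kernel f w z = (1 - f w * cnj (f z)) * szego z w"
      "divided_diff (\<lambda>u. 1) z w = 0"
      by (simp_all add: pick_kernel_def szego_def divided_diff_def mult.commute)
    show ?thesis unfolding eqs by (simp add: algebra_simps)
  qed
  ultimately show ?thesis by (simp only:)
qed

text \<open>The quadratic form is the mean over the circle of the form of the positive semidefinite matrix
  ((1, f), (cnj f, 1)) at the vector (A, B) built from Szego and Cauchy kernels.\<close>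

lemma pick_block_nonneg:
  fixes Z x y :: "nat \<Rightarrow> complex"
  assumes f: "f holomorphic_on cball 0 1" and le: "\<And>u. norm u = 1 \<Longrightarrow> norm (f u) \<le> 1"
    and Z: "\<And>i. i < n \<Longrightarrow> norm (Z i) < 1"
  shows "0 \<le> Re (\<Sum>i<n. \<Sum>j<n. cnj (x i) * pick_kernel f (Z i) (Z j) * x j
      + cnj (y i) * pick_kernel f (Z j) (Z i) * y j
      + 2 * (cnj (x i) * divided_diff f (Z i) (Z j) * y j))"
proof (rule circle_mean_Re_nonneg)
  define a where "a i u = x i * szego (Z i) u - y i * f (Z i) * (1 / (u - Z i))" for i u
  define b where "b i u = y i * (1 / (u - Z i)) - x i * cnj (f (Z i)) * szego (Z i) u" for i u
  show "circle_mean (\<lambda>u. \<Sum>i<n. \<Sum>j<n. a j u * cnj (a i u) + b j u * cnj (b i u)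
        + 2 * (f u * b j u * cnj (a i u)))
      (\<Sum>i<n. \<Sum>j<n. cnj (x i) * pick_kernel f (Z i) (Z j) * x j
      + cnj (y i) * pick_kernel f (Z j) (Z i) * y j
      + 2 * (cnj (x i) * divided_diff f (Z i) (Z j) * y j))"
    unfolding a_def b_def
    by (rule circle_mean_sum circle_mean_sum[OF finite_lessThan] pick_block_term[OF f]
        finite_lessThan | use Z in simp)+
  fix u :: complex assume u: "norm u = 1"
  define A where "A = (\<Sum>i<n. a i u)"
  define B where "B = (\<Sum>i<n. b i u)"
  have *: "(\<Sum>i<n. \<Sum>j<n. a j u * cnj (a i u) + b j u * cnj (b i u)
        + 2 * (f u * b j u * cnj (a i u))) = A * cnj A + B * cnj B + 2 * (f u * B * cnj A)"
  proof -
    have "(\<Sum>i<n. \<Sum>j<n. a j u * cnj (a i u)) = A * cnj A"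
      "(\<Sum>i<n. \<Sum>j<n. b j u * cnj (b i u)) = B * cnj B"
      "(\<Sum>i<n. \<Sum>j<n. f u * b j u * cnj (a i u)) = f u * B * cnj A"
      by (simp_all add: A_def B_def sum_distrib_left sum_distrib_right)
    then show ?thesis
      by (simp add: sum.distrib flip: sum_distrib_left)
  qed
  have "\<bar>Re (f u * B * cnj A)\<bar> \<le> norm (f u * B * cnj A)" by (rule abs_Re_le_cmod)
  also have "\<dots> \<le> norm B * norm A"
    using le[OF u] by (simp add: norm_mult mult_left_le_one_le mult_right_mono)
  finally have "\<bar>Re (f u * B * cnj A)\<bar> \<le> norm B * norm A" .
  moreover have "2 * (norm B * norm A) \<le> (norm A)\<^sup>2 + (norm B)\<^sup>2"
    using sum_squares_bound[of "norm B" "norm A"] by simp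
  moreover have "Re (A * cnj A + B * cnj B + 2 * (f u * B * cnj A)) =
      (norm A)\<^sup>2 + (norm B)\<^sup>2 + 2 * Re (f u * B * cnj A)"
    by (simp add: complex_norm_square[symmetric] del: of_real_power)
  ultimately show "0 \<le> Re (\<Sum>i<n. \<Sum>j<n. a j u * cnj (a i u) + b j u * cnj (b i u)
        + 2 * (f u * b j u * cnj (a i u)))"
    unfolding * by linarith
qed

section \<open>Positive block matrices\<close>

definition sesq :: "nat \<Rightarrow> (nat \<Rightarrow> nat \<Rightarrow> complex) \<Rightarrow> (nat \<Rightarrow> complex) \<Rightarrow> (nat \<Rightarrow> complex) \<Rightarrow> complex" where
  "sesq n P x y = (\<Sum>i<n. \<Sum>j<n. cnj (x i) * P i j * y j)"

lemma sesq_diff_right: "sesq n P x (\<lambda>j. y j - z j) = sesq n P x y - sesq n P x z"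
  by (simp add: sesq_def algebra_simps sum_subtractf)

lemma sesq_scale_right: "sesq n P x (\<lambda>j. c * y j) = c * sesq n P x y"
  by (simp add: sesq_def sum_distrib_left mult_ac)

lemma sesq_scale_left: "sesq n P (\<lambda>j. c * x j) y = cnj c * sesq n P x y"
  by (simp add: sesq_def sum_distrib_left mult_ac)

lemma sesq_sum_right: "sesq n P x (\<lambda>j. \<Sum>k\<in>K. y k j) = (\<Sum>k\<in>K. sesq n P x (y k))"
proof -
  have "sesq n P x (\<lambda>j. \<Sum>k\<in>K. y k j) = (\<Sum>i<n. \<Sum>j<n. \<Sum>k\<in>K. cnj (x i) * P i j * y k j)"
    by (simp add: sesq_def sum_distrib_left)
  also have "\<dots> = (\<Sum>i<n. \<Sum>k\<in>K. \<Sum>j<n. cnj (x i) * P i j * y k j)"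
    by (intro sum.cong refl sum.swap)
  also have "\<dots> = (\<Sum>k\<in>K. sesq n P x (y k))"
    unfolding sesq_def by (rule sum.swap)
  finally show ?thesis .
qed

lemma sesq_cnj:
  assumes "\<And>i j. i < n \<Longrightarrow> j < n \<Longrightarrow> P j i = cnj (P i j)"
  shows "cnj (sesq n P x y) = sesq n P y x"
proof -
  have "cnj (P i j) = P j i" if "i < n" "j < n" for i j
    using assms[OF that] by simp
  then have "cnj (sesq n P x y) = (\<Sum>i<n. \<Sum>j<n. cnj (y j) * P j i * x i)"
    by (simp add: sesq_def mult_ac)
  also have "\<dots> = sesq n P y x"
    unfolding sesq_def by (rule sum.swap)
  finally show ?thesis .
qed

lemma sesq_real:
  assumes "\<And>i j. i < n \<Longrightarrow> j < n \<Longrightarrow> P j i = cnj (P i j)"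
  shows "sesq n P x x = of_real (Re (sesq n P x x))"
  using sesq_cnj[of n P x x, OF assms] by (simp add: complex_eq_iff)

lemma sesq_truncate:
  "sesq (Suc n) P (\<lambda>i. if i < n then x i else 0) (\<lambda>i. if i < n then y i else 0) = sesq n P x y"
  by (simp add: sesq_def)

text \<open>Vectors extend by zero, so positivity passes to the leading block; one Gram-Schmidt step
  then adjoins the last unit vector.\<close>

lemma gram_schmidt_sesq:
  assumes herm: "\<And>i j. i < n \<Longrightarrow> j < n \<Longrightarrow> P j i = cnj (P i j)"
    and pos: "\<And>x. \<exists>i<n. x i \<noteq> 0 \<Longrightarrow> 0 < Re (sesq n P x x)"
  shows "\<exists>X. \<forall>k<n. \<forall>l<n. sesq n P (X k) (X l) = (if k = l then 1 else 0)"
  using assms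
proof (induction n)
  case 0
  then show ?case by simp
next
  case (Suc n)
  have pos_n: "0 < Re (sesq n P x x)" if "\<exists>i<n. x i \<noteq> 0" for x
  proof -
    have "\<exists>i<Suc n. (if i < n then x i else 0) \<noteq> 0"
      using that by (metis less_SucI)
    from Suc.prems(2)[OF this] show ?thesis by (simp add: sesq_truncate)
  qed
  obtain Y where Y: "\<And>k l. k < n \<Longrightarrow> l < n \<Longrightarrow> sesq n P (Y k) (Y l) = (if k = l then 1 else 0)"
    using Suc.IH[OF _ pos_n] Suc.prems(1) by (metis less_SucI)
  define X where "X k i = (if i < n then Y k i else 0)" for k i
  let ?F = "sesq (Suc n) P"
  have X: "?F (X k) (X l) = (if k = l then 1 else 0)" if "k < n" "l < n" for k l
    using Y[OF that] unfolding X_def sesq_truncate .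
  define e :: "nat \<Rightarrow> complex" where "e i = (if i = n then 1 else 0)" for i
  define v where "v i = e i - (\<Sum>k<n. ?F (X k) e * X k i)" for i
  have orth: "?F (X l) v = 0" if "l < n" for l
  proof -
    have "?F (X l) v = ?F (X l) e - (\<Sum>k<n. ?F (X k) e * ?F (X l) (X k))"
      unfolding v_def sesq_diff_right sesq_sum_right sesq_scale_right ..
    also have "(\<Sum>k<n. ?F (X k) e * ?F (X l) (X k)) = (\<Sum>k<n. if k = l then ?F (X l) e else 0)"
      by (intro sum.cong refl) (use that in \<open>auto simp: X\<close>)
    finally show ?thesis using that by simp
  qed
  have orth': "?F v (X l) = 0" if "l < n" for l
    using orth[OF that] sesq_cnj[of "Suc n" P "X l" v, OF Suc.prems(1)] by simp
  define \<beta> where "\<beta> = Re (?F v v)"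
  \<comment> \<open>The earlier basis vectors vanish at index n, so v keeps the entry 1 of e there
    and is nonzero.\<close>
  have "v n = 1" by (simp add: v_def e_def X_def)
  then have "\<beta> > 0"
    unfolding \<beta>_def by (intro Suc.prems(2) exI[of _ n]) simp
  define c where "c = complex_of_real (1 / sqrt \<beta>)"
  have Fvv: "?F v v = of_real \<beta>"
    using sesq_real[of "Suc n" P v, OF Suc.prems(1)] by (simp add: \<beta>_def)
  have "c * (cnj c * ?F v v) = 1"
    using \<open>\<beta> > 0\<close> by (simp add: c_def Fvv flip: of_real_mult)
  then show ?case
    using X orth orth'
    by (intro exI[of _ "\<lambda>k. if k < n then X k else (\<lambda>j. c * v j)"])
      (auto simp: less_Suc_eq sesq_scale_left sesq_scale_right)
qed

text \<open>Summing the block inequality over the pairs consisting of a basis vector x orthonormal for P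
  and the vector y with entries - s * c j * (P x) j turns it into a quadratic inequality in the scalar s;
  this choice of y makes the off-diagonal entries of N cancel.\<close>

lemma diagonal_bound_posdef:
  fixes P N :: "nat \<Rightarrow> nat \<Rightarrow> complex"
  assumes herm: "\<And>i j. i < n \<Longrightarrow> j < n \<Longrightarrow> P j i = cnj (P i j)"
    and pos: "\<And>x. \<exists>i<n. x i \<noteq> 0 \<Longrightarrow> 0 < Re (sesq n P x x)"
    and block: "\<And>x y. 0 \<le> Re (\<Sum>i<n. \<Sum>j<n. cnj (x i) * P i j * x j + cnj (y i) * P j i * y j
      + 2 * (cnj (x i) * N i j * y j))"
  shows "(cmod (\<Sum>i<n. c i * N i i))\<^sup>2 \<le> real n * Re (\<Sum>i<n. \<Sum>j<n. cnj (c i) * (P j i)\<^sup>2 * c j)"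
proof -
  have cnj_P: "cnj (P i j) = P j i" if "i < n" "j < n" for i j
    using herm[OF that] by simp
  obtain X where X: "\<And>k l. k < n \<Longrightarrow> l < n \<Longrightarrow> sesq n P (X k) (X l) = (if k = l then 1 else 0)"
    using gram_schmidt_sesq[OF herm pos] by metis
  define u where "u k j = (\<Sum>m<n. P j m * X k m)" for k j
  \<comment> \<open>Orthonormality makes the matrix X* P a left inverse of the square matrix X. It
    is then also a right inverse, which is this completeness relation.\<close>
  have delta: "(\<Sum>k<n. cnj (X k i) * u k j) = (if i = j then 1 else 0)" if "i < n" "j < n" for i j
  proof -
    define XM where "XM = mat n n (\<lambda>(i, k). X k i)"
    define AM where "AM = mat n n (\<lambda>(k, j). \<Sum>i<n. cnj (X k i) * P i j)"
    have dims: "XM \<in> carrier_mat n n" "AM \<in> carrier_mat n n"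
      by (auto simp: XM_def AM_def)
    have "AM * XM = 1\<^sub>m n"
    proof (rule eq_matI)
      fix k l assume "k < dim_row (1\<^sub>m n)" "l < dim_col (1\<^sub>m n)"
      then have kl: "k < n" "l < n" by auto
      have "(AM * XM) $$ (k, l) = (\<Sum>j<n. (\<Sum>i<n. cnj (X k i) * P i j) * X l j)"
        using kl by (simp add: XM_def AM_def scalar_prod_def lessThan_atLeast0)
      also have "\<dots> = (\<Sum>j<n. \<Sum>i<n. cnj (X k i) * P i j * X l j)"
        by (simp add: sum_distrib_right)
      also have "\<dots> = sesq n P (X k) (X l)"
        unfolding sesq_def by (rule sum.swap)
      finally show "(AM * XM) $$ (k, l) = 1\<^sub>m n $$ (k, l)"
        using X kl by simp
    qed (use dims in auto)
    then have XA: "XM * AM = 1\<^sub>m n"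
      using mat_mult_left_right_inverse dims by blast
    have "(XM * AM) $$ (i, j) = (\<Sum>k<n. X k i * (\<Sum>m<n. cnj (X k m) * P m j))"
      using that by (simp add: XM_def AM_def scalar_prod_def lessThan_atLeast0)
    also have "\<dots> = (\<Sum>k<n. X k i * cnj (u k j))"
      using that by (simp add: u_def cnj_P mult_ac)
    finally have "(\<Sum>k<n. X k i * cnj (u k j)) = (if i = j then 1 else 0)"
      using XA that by simp
    from arg_cong[OF this, of cnj] show ?thesis by (simp split: if_splits)
  qed
  \<comment> \<open>This is P X X* P = P, by completeness.\<close>
  have gram_u: "(\<Sum>k<n. cnj (u k i) * u k j) = P j i" if "i < n" "j < n" for i j
  proof -
    have "(\<Sum>k<n. cnj (u k i) * u k j) = (\<Sum>k<n. \<Sum>m<n. cnj (P i m) * (cnj (X k m) * u k j))"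
      by (simp add: u_def[of _ i] sum_distrib_right mult.assoc)
    also have "\<dots> = (\<Sum>m<n. cnj (P i m) * (\<Sum>k<n. cnj (X k m) * u k j))"
      by (subst sum.swap) (simp add: sum_distrib_left)
    also have "\<dots> = (\<Sum>m<n. if m = j then cnj (P i j) else 0)"
      by (intro sum.cong refl) (use delta that in auto)
    finally show ?thesis using cnj_P[OF that] that by simp
  qed
  define D where "D = (\<Sum>i<n. c i * N i i)"
  define Q where "Q = (\<Sum>i<n. \<Sum>j<n. cnj (c i) * (P j i)\<^sup>2 * c j)"
  \<comment> \<open>The constant n is the sum of the squared norms of the n basis vectors. In the
    quadratic term one factor P comes from the block and another from the Gram matrix of u, which
    produces the entrywise square of P.\<close>
  have quad: "0 \<le> real n + (cmod s)\<^sup>2 * Re Q - 2 * Re (s * D)" for s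
  proof -
    have "0 \<le> (\<Sum>k<n. Re (\<Sum>i<n. \<Sum>j<n. cnj (X k i) * P i j * X k j
        + cnj (- s * c i * u k i) * P j i * (- s * c j * u k j)
        + 2 * (cnj (X k i) * N i j * (- s * c j * u k j))))"
      by (rule sum_nonneg) (rule block)
    also have "\<dots> = Re (\<Sum>k<n. \<Sum>i<n. \<Sum>j<n. cnj (X k i) * P i j * X k j
        + cnj (- s * c i * u k i) * P j i * (- s * c j * u k j)
        + 2 * (cnj (X k i) * N i j * (- s * c j * u k j)))"
      by (rule Re_sum[symmetric])
    also have "(\<Sum>k<n. \<Sum>i<n. \<Sum>j<n. cnj (X k i) * P i j * X k j
        + cnj (- s * c i * u k i) * P j i * (- s * c j * u k j)
        + 2 * (cnj (X k i) * N i j * (- s * c j * u k j))) =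
        (\<Sum>k<n. sesq n P (X k) (X k))
        + (\<Sum>k<n. \<Sum>i<n. \<Sum>j<n. s * cnj s * (cnj (c i) * P j i * c j) * (cnj (u k i) * u k j))
        + (\<Sum>k<n. \<Sum>i<n. \<Sum>j<n. - 2 * s * (N i j * c j) * (cnj (X k i) * u k j))"
      unfolding sesq_def by (simp add: mult_ac sum_negf sum.distrib sum_subtractf)
    also have "(\<Sum>k<n. sesq n P (X k) (X k)) = of_nat n"
      using X by simp
    also have "(\<Sum>k<n. \<Sum>i<n. \<Sum>j<n. s * cnj s * (cnj (c i) * P j i * c j) * (cnj (u k i) * u k j)) =
        (\<Sum>i<n. \<Sum>j<n. s * cnj s * (cnj (c i) * P j i * c j) * (\<Sum>k<n. cnj (u k i) * u k j))"
      unfolding sum_distrib_left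
      by (subst sum.swap, rule sum.cong[OF refl], rule sum.swap)
    also have "\<dots> = (\<Sum>i<n. \<Sum>j<n. s * cnj s * (cnj (c i) * (P j i)\<^sup>2 * c j))"
      by (intro sum.cong refl) (simp add: gram_u power2_eq_square)
    also have "\<dots> = s * cnj s * Q"
      by (simp add: Q_def sum_distrib_left)
    also have "(\<Sum>k<n. \<Sum>i<n. \<Sum>j<n. - 2 * s * (N i j * c j) * (cnj (X k i) * u k j)) =
        (\<Sum>i<n. \<Sum>j<n. - 2 * s * (N i j * c j) * (\<Sum>k<n. cnj (X k i) * u k j))"
      unfolding sum_distrib_left
      by (subst sum.swap, rule sum.cong[OF refl], rule sum.swap)
    also have "\<dots> = (\<Sum>i<n. \<Sum>j<n. if i = j then - 2 * s * (c i * N i i) else 0)"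
      by (intro sum.cong refl) (auto simp: delta)
    also have "\<dots> = - 2 * (s * D)"
      by (simp add: D_def sum_distrib_left mult_ac sum_negf)
    finally have "0 \<le> Re (of_nat n + of_real ((cmod s)\<^sup>2) * Q + - 2 * (s * D))"
      by (simp only: complex_norm_square)
    then show ?thesis by simp
  qed
  show ?thesis
  proof (cases "D = 0")
    case False
    \<comment> \<open>The choice s = n / D makes the linear term equal to -2n and avoids dividing by
      \<open>Re Q\<close>, which is not known to be positive.\<close>
    have "0 \<le> real n + (real n / cmod D)\<^sup>2 * Re Q - 2 * real n"
      using quad[of "of_nat n / D"] False by (simp add: norm_divide)
    then have "real n * (cmod D)\<^sup>2 \<le> real n * (real n * Re Q)"
      using False by (simp add: field_simps power2_eq_square)
    moreover have "n > 0" using False by (auto simp: D_def intro: ccontr)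
    ultimately show ?thesis
      using D_def Q_def by simp
  next
    case True
    \<comment> \<open>For D = 0 the linear term is absent; if \<open>Re Q\<close> were negative, a
      scalar with squared modulus 2n / (- Re Q) would bring the right-hand side of
      \<open>quad\<close> down to -n.\<close>
    have "0 \<le> real n * Re Q"
    proof (rule ccontr)
      assume neg: "\<not> 0 \<le> real n * Re Q"
      then have "Re Q < 0" "n > 0" by (auto simp: mult_less_0_iff not_le)
      have "0 \<le> real n + 2 * real n / (- Re Q) * Re Q"
        using quad[of "of_real (sqrt (2 * real n / (- Re Q)))"] True \<open>Re Q < 0\<close>
        by (simp add: divide_nonneg_neg norm_mult)
      then show False using \<open>Re Q < 0\<close> \<open>n > 0\<close> by simp
    qed
    then show ?thesis using True by (simp add: D_def Q_def)
  qed
qed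

text \<open>The Pick matrix can be singular, for instance when points coincide, and then no
  orthonormal basis exists. Adding \<epsilon> times the identity to P preserves the block inequality
  and makes P definite, since the case y = 0 of that inequality says that P is semidefinite. The
  bound is continuous in \<epsilon>.\<close>

lemma diagonal_bound:
  fixes P N :: "nat \<Rightarrow> nat \<Rightarrow> complex"
  assumes herm: "\<And>i j. i < n \<Longrightarrow> j < n \<Longrightarrow> P j i = cnj (P i j)"
    and block: "\<And>x y. 0 \<le> Re (\<Sum>i<n. \<Sum>j<n. cnj (x i) * P i j * x j + cnj (y i) * P j i * y j
      + 2 * (cnj (x i) * N i j * y j))"
  shows "(cmod (\<Sum>i<n. c i * N i i))\<^sup>2 \<le> real n * Re (\<Sum>i<n. \<Sum>j<n. cnj (c i) * (P j i)\<^sup>2 * c j)"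
proof -
  define Pe where "Pe \<epsilon> i j = P i j + (if i = j then complex_of_real \<epsilon> else 0)" for \<epsilon> i j
  have bound: "(cmod (\<Sum>i<n. c i * N i i))\<^sup>2
      \<le> real n * Re (\<Sum>i<n. \<Sum>j<n. cnj (c i) * (Pe \<epsilon> j i)\<^sup>2 * c j)" if "\<epsilon> > 0" for \<epsilon>
  proof (rule diagonal_bound_posdef[where P = "Pe \<epsilon>" and N = N])
    show "Pe \<epsilon> j i = cnj (Pe \<epsilon> i j)" if "i < n" "j < n" for i j
      unfolding Pe_def complex_cnj_add herm[OF that] by simp
    have diag: "(\<Sum>i<n. \<Sum>j<n. cnj (x i) * (if i = j then complex_of_real \<epsilon> else 0) * x j)
        = of_real (\<epsilon> * (\<Sum>i<n. (cmod (x i))\<^sup>2))" for x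
    proof -
      have "(\<Sum>i<n. \<Sum>j<n. cnj (x i) * (if i = j then complex_of_real \<epsilon> else 0) * x j)
          = (\<Sum>i<n. \<Sum>j<n. if i = j then of_real \<epsilon> * (x i * cnj (x i)) else 0)"
        by (intro sum.cong refl) auto
      then show ?thesis
        by (simp add: sum_distrib_left complex_norm_square del: of_real_power)
    qed
    have shift: "(\<Sum>i<n. \<Sum>j<n. cnj (x i) * Pe \<epsilon> i j * x j + cnj (y i) * Pe \<epsilon> j i * y j
      + 2 * (cnj (x i) * N i j * y j)) =
      (\<Sum>i<n. \<Sum>j<n. cnj (x i) * P i j * x j + cnj (y i) * P j i * y j
      + 2 * (cnj (x i) * N i j * y j))
      + of_real (\<epsilon> * (\<Sum>i<n. (cmod (x i))\<^sup>2)) + of_real (\<epsilon> * (\<Sum>i<n. (cmod (y i))\<^sup>2))" for x y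
      unfolding diag[symmetric] sum.distrib[symmetric]
      by (intro sum.cong refl) (auto simp: Pe_def algebra_simps)
    show "0 \<le> Re (\<Sum>i<n. \<Sum>j<n. cnj (x i) * Pe \<epsilon> i j * x j + cnj (y i) * Pe \<epsilon> j i * y j
      + 2 * (cnj (x i) * N i j * y j))" for x y
      using block[of x y] \<open>\<epsilon> > 0\<close> unfolding shift by (simp add: sum_nonneg)
    show "0 < Re (sesq n (Pe \<epsilon>) x x)" if "\<exists>i<n. x i \<noteq> 0" for x
    proof -
      have "0 < (\<Sum>i<n. (cmod (x i))\<^sup>2)"
      proof -
        from that obtain i where "i < n" "x i \<noteq> 0" by blast
        then show ?thesis by (intro sum_pos2[of _ i]) auto
      qed
      then show ?thesis
        using block[of x "\<lambda>_. 0"] shift[of x "\<lambda>_. 0"] \<open>\<epsilon> > 0\<close>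
        by (simp add: sesq_def add_nonneg_pos)
    qed
  qed
  have Pe_tendsto: "((\<lambda>\<epsilon>. Pe \<epsilon> j i) \<longlongrightarrow> Pe 0 j i) (at_right 0)" for i j
    unfolding Pe_def by (cases "j = i") (auto intro!: tendsto_eq_intros)
  have "((\<lambda>\<epsilon>. real n * Re (\<Sum>i<n. \<Sum>j<n. cnj (c i) * (Pe \<epsilon> j i)\<^sup>2 * c j)) \<longlongrightarrow>
      real n * Re (\<Sum>i<n. \<Sum>j<n. cnj (c i) * (Pe 0 j i)\<^sup>2 * c j)) (at_right 0)"
    by (intro tendsto_intros Pe_tendsto)
  moreover have "eventually (\<lambda>\<epsilon>. (cmod (\<Sum>i<n. c i * N i i))\<^sup>2 \<le>
      real n * Re (\<Sum>i<n. \<Sum>j<n. cnj (c i) * (Pe \<epsilon> j i)\<^sup>2 * c j)) (at_right 0)"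
    using eventually_at_right_less[of 0] by eventually_elim (rule bound)
  ultimately have "(cmod (\<Sum>i<n. c i * N i i))\<^sup>2 \<le>
      real n * Re (\<Sum>i<n. \<Sum>j<n. cnj (c i) * (Pe 0 j i)\<^sup>2 * c j)"
    by (intro tendsto_lowerbound[of _ _ "at_right 0"]) auto
  moreover have "Pe 0 = P"
    by (simp add: Pe_def fun_eq_iff)
  ultimately show ?thesis by simp
qed

section \<open>Passing to the Loewner order\<close>

lemma mat_adjoint_index:
  "i < dim_col A \<Longrightarrow> j < dim_row A \<Longrightarrow> mat_adjoint A $$ (i, j) = conjugate (A $$ (j, i))"
  by (simp add: mat_adjoint_def mat_of_rows_index)

lemma hermitian_mat_iff:
  "hermitian_mat (mat n n (\<lambda>(i, j). a i j)) \<longleftrightarrow> (\<forall>i<n. \<forall>j<n. a j i = cnj (a i j))"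
  (is "hermitian_mat ?A \<longleftrightarrow> _")
proof -
  have "dim_row (mat_adjoint ?A) = n" "dim_col (mat_adjoint ?A) = n"
    by (auto simp: mat_adjoint_def)
  then have "mat_adjoint ?A = ?A \<longleftrightarrow> (\<forall>i<n. \<forall>j<n. cnj (a j i) = a i j)"
    by (simp add: mat_eq_iff mat_adjoint_index conjugate_complex_def)
  also have "\<dots> \<longleftrightarrow> (\<forall>i<n. \<forall>j<n. a j i = cnj (a i j))"
    by (metis complex_cnj_cnj)
  finally show ?thesis
    by (simp add: hermitian_mat_def)
qed

text \<open>A Hermitian form has real values, so the complex order in \<open>psd_mat\<close> reduces
  to real parts, and test vectors can be functions of which only the first n values count.\<close>

lemma loewner_le_mat_iff:
  assumes a: "\<And>i j. i < n \<Longrightarrow> j < n \<Longrightarrow> a j i = cnj (a i j)"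
    and b: "\<And>i j. i < n \<Longrightarrow> j < n \<Longrightarrow> b j i = cnj (b i j)"
  shows "mat n n (\<lambda>(i, j). a i j) \<le>\<^sub>L mat n n (\<lambda>(i, j). b i j) \<longleftrightarrow>
    (\<forall>v. 0 \<le> Re (sesq n (\<lambda>i j. b i j - a i j) v v))"
proof -
  let ?c = "\<lambda>i j. b i j - a i j"
  have c: "?c j i = cnj (?c i j)" if "i < n" "j < n" for i j
    unfolding complex_cnj_diff a[OF that] b[OF that] by simp
  have herm: "hermitian_mat (mat n n (\<lambda>(i, j). a i j))" "hermitian_mat (mat n n (\<lambda>(i, j). b i j))"
    "hermitian_mat (mat n n (\<lambda>(i, j). ?c i j))"
    unfolding hermitian_mat_iff using a b c by blast+
  have diff: "mat n n (\<lambda>(i, j). b i j) - mat n n (\<lambda>(i, j). a i j) = mat n n (\<lambda>(i, j). ?c i j)"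
    by (rule eq_matI) auto
  have form: "(mat n n (\<lambda>(i, j). ?c i j) *\<^sub>v v) \<bullet>c v = sesq n ?c (\<lambda>i. v $ i) (\<lambda>i. v $ i)"
    if "v \<in> carrier_vec n" for v
    using that
    by (simp add: scalar_prod_def sesq_def lessThan_atLeast0 sum_distrib_left mult_ac)
  have "psd_mat (mat n n (\<lambda>(i, j). ?c i j)) \<longleftrightarrow>
      (\<forall>v\<in>carrier_vec n. 0 \<le> sesq n ?c (\<lambda>i. v $ i) (\<lambda>i. v $ i))"
    by (simp add: psd_mat_def herm form)
  also have "\<dots> \<longleftrightarrow> (\<forall>v\<in>carrier_vec n. 0 \<le> Re (sesq n ?c (\<lambda>i. v $ i) (\<lambda>i. v $ i)))"
  proof -
    have "0 \<le> sesq n ?c x x \<longleftrightarrow> 0 \<le> Re (sesq n ?c x x)" for x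
      by (subst sesq_real[of n ?c, OF c]) (simp_all add: less_eq_complex_def)
    then show ?thesis by simp
  qed
  also have "\<dots> \<longleftrightarrow> (\<forall>v. 0 \<le> Re (sesq n ?c v v))"
  proof (intro iffI allI)
    fix v :: "nat \<Rightarrow> complex"
    assume *: "\<forall>v\<in>carrier_vec n. 0 \<le> Re (sesq n ?c (\<lambda>i. v $ i) (\<lambda>i. v $ i))"
    have "sesq n ?c (\<lambda>i. vec n v $ i) (\<lambda>i. vec n v $ i) = sesq n ?c v v"
      by (simp add: sesq_def)
    then show "0 \<le> Re (sesq n ?c v v)"
      using *[rule_format, of "vec n v"] by simp
  qed auto
  finally show ?thesis
    by (simp add: loewner_le_def diff herm)
qed

lemma norm_mult_cnj_less_1: "norm z < 1 \<Longrightarrow> norm w < 1 \<Longrightarrow> norm (z * cnj w) < 1"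
  using mult_strict_mono'[of "norm z" 1 "norm w" 1] by (simp add: norm_mult)

text \<open>The Hadamard product with 1 / (1 - f z * cnj (f w)) ^ 2 takes the square of the Pick kernel
  to G and the rank one matrix of f' to H; it preserves positivity because its power series
  has nonnegative coefficients.\<close>

lemma H_mat_le_G_mat:
  assumes Z: "\<And>i. i < n \<Longrightarrow> norm (Z i) < 1" and fZ: "\<And>i. i < n \<Longrightarrow> norm (f (Z i)) < 1"
    and bound: "\<And>c. (cmod (\<Sum>i<n. c i * deriv f (Z i)))\<^sup>2 \<le>
      m * Re (\<Sum>i<n. \<Sum>j<n. cnj (c i) * (pick_kernel f (Z j) (Z i))\<^sup>2 * c j)"
  shows "H_mat n f Z \<le>\<^sub>L of_real m \<cdot>\<^sub>m G_mat n Z"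
proof -
  define h where "h i j = deriv f (Z i) * cnj (deriv f (Z j)) / (1 - f (Z i) * cnj (f (Z j)))\<^sup>2" for i j
  define g where "g i j = of_real m * (1 / (1 - Z i * cnj (Z j))\<^sup>2)" for i j
  define M where "M i j = of_real m * (pick_kernel f (Z i) (Z j))\<^sup>2
    - deriv f (Z i) * cnj (deriv f (Z j))" for i j
  have mats: "H_mat n f Z = mat n n (\<lambda>(i, j). h i j)"
    "of_real m \<cdot>\<^sub>m G_mat n Z = mat n n (\<lambda>(i, j). g i j)"
    by (auto simp: H_mat_def G_mat_def h_def g_def)
  \<comment> \<open>This is the hypothesis \<open>bound\<close> with the summation indices exchanged
    and the rank one part read as a squared modulus.\<close>
  have M_nonneg: "0 \<le> Re (\<Sum>i<n. \<Sum>j<n. c i * cnj (c j) * M i j)" for c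
  proof -
    have "(\<Sum>i<n. \<Sum>j<n. c i * cnj (c j) * M i j) =
        of_real m * (\<Sum>i<n. \<Sum>j<n. cnj (c j) * (pick_kernel f (Z i) (Z j))\<^sup>2 * c i)
        - (\<Sum>i<n. \<Sum>j<n. (c i * deriv f (Z i)) * cnj (c j * deriv f (Z j)))"
      unfolding sum_distrib_left sum_subtractf[symmetric]
      by (intro sum.cong refl) (simp add: M_def algebra_simps)
    also have "(\<Sum>i<n. \<Sum>j<n. cnj (c j) * (pick_kernel f (Z i) (Z j))\<^sup>2 * c i) =
        (\<Sum>i<n. \<Sum>j<n. cnj (c i) * (pick_kernel f (Z j) (Z i))\<^sup>2 * c j)"
      by (rule sum.swap)
    also have "(\<Sum>i<n. \<Sum>j<n. (c i * deriv f (Z i)) * cnj (c j * deriv f (Z j))) =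
        of_real ((cmod (\<Sum>i<n. c i * deriv f (Z i)))\<^sup>2)"
      unfolding complex_norm_square cnj_sum sum_product ..
    finally show ?thesis
      using bound[of c] by simp
  qed
  have "0 \<le> Re (sesq n (\<lambda>i j. g i j - h i j) v v)" for v
  proof -
    have entry: "(\<lambda>k. cnj (v i) * v j * M i j * (of_nat (Suc k) * (f (Z i) * cnj (f (Z j))) ^ k))
        sums (cnj (v i) * (g i j - h i j) * v j)" if ij: "i < n" "j < n" for i j
    proof -
      have "norm (f (Z i) * cnj (f (Z j))) < 1"
        using fZ ij by (intro norm_mult_cnj_less_1) auto
      from sums_mult[OF geometric_deriv_sums[OF this], of "cnj (v i) * v j * M i j"]
      have "(\<lambda>k. cnj (v i) * v j * M i j * (of_nat (Suc k) * (f (Z i) * cnj (f (Z j))) ^ k)) sums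
        (cnj (v i) * v j * M i j * (1 / (1 - f (Z i) * cnj (f (Z j)))\<^sup>2))" .
      moreover define u where "u = 1 - f (Z i) * cnj (f (Z j))"
      have "u \<noteq> 0"
        using \<open>norm (f (Z i) * cnj (f (Z j))) < 1\<close> by (force simp: u_def)
      then have "g i j - h i j = M i j * (1 / (1 - f (Z i) * cnj (f (Z j)))\<^sup>2)"
        unfolding g_def h_def M_def pick_kernel_def u_def[symmetric]
        by (simp add: power_divide diff_divide_distrib)
      ultimately show ?thesis by (simp add: mult_ac)
    qed
    have "(\<lambda>k. \<Sum>i<n. \<Sum>j<n. cnj (v i) * v j * M i j * (of_nat (Suc k) * (f (Z i) * cnj (f (Z j))) ^ k))
        sums (sesq n (\<lambda>i j. g i j - h i j) v v)"
      unfolding sesq_def by (intro sums_sum entry) auto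
    then have S: "(\<lambda>k. Re (\<Sum>i<n. \<Sum>j<n. cnj (v i) * v j * M i j *
          (of_nat (Suc k) * (f (Z i) * cnj (f (Z j))) ^ k)))
        sums Re (sesq n (\<lambda>i j. g i j - h i j) v v)"
      by (rule sums_Re)
    have nonneg: "0 \<le> Re (\<Sum>i<n. \<Sum>j<n. cnj (v i) * v j * M i j *
          (of_nat (Suc k) * (f (Z i) * cnj (f (Z j))) ^ k))" for k
    proof -
      \<comment> \<open>The powers of the values of f are absorbed into the test vector, so the k-th
        term of the series of 1 / (1 - x)^2 contributes k + 1 times the form of M at c.\<close>
      define c where "c i = cnj (v i) * f (Z i) ^ k" for i
      have "(\<Sum>i<n. \<Sum>j<n. cnj (v i) * v j * M i j * (of_nat (Suc k) * (f (Z i) * cnj (f (Z j))) ^ k))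
          = of_real (real (Suc k)) * (\<Sum>i<n. \<Sum>j<n. c i * cnj (c j) * M i j)"
        unfolding sum_distrib_left
        by (intro sum.cong refl) (simp add: c_def power_mult_distrib mult_ac)
      then show ?thesis
        using M_nonneg[of c] by (simp del: of_nat_Suc)
    qed
    show ?thesis
      by (rule sums_le[OF nonneg sums_zero S])
  qed
  moreover have herm: "h j i = cnj (h i j)" "g j i = cnj (g i j)" for i j
    by (simp_all add: g_def h_def mult.commute)
  ultimately show ?thesis
    unfolding mats loewner_le_mat_iff[of n h g, OF herm] by blast
qed

section \<open>Self-maps of the disc\<close>

lemma pick_kernel_hermitian: "pick_kernel f w z = cnj (pick_kernel f z w)"
  by (simp add: pick_kernel_def mult.commute)

text \<open>The circle argument requires f on the closed disc, where it need not extend. The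
  dilations \<open>fr r\<close> do, and both sides of the inequality are continuous as r tends to 1
  because all points lie inside the disc.\<close>

lemma self_map_diagonal_bound:
  assumes f: "f holomorphic_on unit_disc" "f ` unit_disc \<subseteq> unit_disc"
    and Z: "\<And>i. i < n \<Longrightarrow> norm (Z i) < 1"
  shows "(cmod (\<Sum>i<n. c i * deriv f (Z i)))\<^sup>2 \<le>
    real n * Re (\<Sum>i<n. \<Sum>j<n. cnj (c i) * (pick_kernel f (Z j) (Z i))\<^sup>2 * c j)"
proof -
  define fr where "fr r z = f (of_real r * z)" for r :: real and z
  define L where "L r = (cmod (\<Sum>i<n. c i * (of_real r * deriv f (of_real r * Z i))))\<^sup>2" for r :: real
  define R where "R r = real n * Re (\<Sum>i<n. \<Sum>j<n. cnj (c i) * (pick_kernel (fr r) (Z j) (Z i))\<^sup>2 * c j)"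
    for r :: real
  have bound: "L r \<le> R r" if r: "0 < r" "r < 1" for r
  proof -
    have in_disc: "of_real r * z \<in> unit_disc" if "norm z \<le> 1" for z
    proof -
      have "r * norm z \<le> r * 1"
        using that r by (intro mult_left_mono) auto
      with r have "r * norm z < 1" by linarith
      with r show ?thesis by (simp add: norm_mult)
    qed
    have hol: "fr r holomorphic_on cball 0 1"
      unfolding fr_def
      by (rule holomorphic_on_compose_gen[OF _ f(1), unfolded o_def])
        (use in_disc in \<open>auto intro!: holomorphic_intros\<close>)
    have le: "norm (fr r u) \<le> 1" if "norm u = 1" for u
      using in_disc[of u] that f(2) by (fastforce simp: fr_def)
    have "deriv (fr r) (Z i) = of_real r * deriv f (of_real r * Z i)" if "i < n" for i
    proof -
      have "(f has_field_derivative deriv f (of_real r * Z i)) (at (of_real r * Z i))"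
        using f(1) in_disc[of "Z i"] Z[OF that] by (intro holomorphic_derivI[of f unit_disc]) auto
      then have "(fr r has_field_derivative deriv f (of_real r * Z i) * of_real r) (at (Z i))"
        unfolding fr_def
        by (rule DERIV_chain2[where g = "\<lambda>z. of_real r * z"]) (auto intro!: derivative_eq_intros)
      then show ?thesis by (simp add: DERIV_imp_deriv mult.commute)
    qed
    then have "L r = (cmod (\<Sum>i<n. c i * divided_diff (fr r) (Z i) (Z i)))\<^sup>2"
      by (simp add: L_def divided_diff_def)
    also have "\<dots> \<le> R r"
      unfolding R_def
      by (rule diagonal_bound[where P = "\<lambda>i j. pick_kernel (fr r) (Z i) (Z j)"
            and N = "\<lambda>i j. divided_diff (fr r) (Z i) (Z j)"])
        (rule pick_kernel_hermitian, rule pick_block_nonneg[OF hol le Z])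
    finally show ?thesis .
  qed
  have cont: "isCont f z" "isCont (deriv f) z" if "norm z < 1" for z
    using that holomorphic_on_imp_continuous_on[OF f(1)]
      holomorphic_on_imp_continuous_on[OF holomorphic_deriv[OF f(1) open_ball]]
    by (simp_all add: continuous_on_eq_continuous_at)
  have lim_scale: "((\<lambda>r. of_real r * z) \<longlongrightarrow> z) (at_left 1)" for z :: complex
    by (auto intro!: tendsto_eq_intros)
  have lim_f: "((\<lambda>r. f (of_real r * Z i)) \<longlongrightarrow> f (Z i)) (at_left 1)"
    and lim_f': "((\<lambda>r. deriv f (of_real r * Z i)) \<longlongrightarrow> deriv f (Z i)) (at_left 1)" if "i < n" for i
    using cont[OF Z[OF that]] lim_scale[of "Z i"] by (auto intro: isCont_tendsto_compose)
  have lim_kernel: "((\<lambda>r. pick_kernel (fr r) (Z j) (Z i)) \<longlongrightarrow> pick_kernel f (Z j) (Z i)) (at_left 1)"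
    if "i < n" "j < n" for i j
  proof -
    have "1 - Z j * cnj (Z i) \<noteq> 0"
      using szego_denominator[of "Z i" "Z j"] Z that by (simp add: mult.commute less_imp_le)
    then show ?thesis
      unfolding pick_kernel_def fr_def by (intro tendsto_intros lim_f that)
  qed
  have lim_L: "(L \<longlongrightarrow> (cmod (\<Sum>i<n. c i * (of_real 1 * deriv f (Z i))))\<^sup>2) (at_left 1)"
    unfolding L_def by (intro tendsto_intros lim_f') auto
  have lim_R: "(R \<longlongrightarrow>
      real n * Re (\<Sum>i<n. \<Sum>j<n. cnj (c i) * (pick_kernel f (Z j) (Z i))\<^sup>2 * c j)) (at_left 1)"
    unfolding R_def by (intro tendsto_intros lim_kernel) auto
  have "eventually (\<lambda>r. r \<in> {0<..<1}) (at_left (1::real))"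
    by (rule eventually_at_left_real) simp
  then have "eventually (\<lambda>r. L r \<le> R r) (at_left 1)"
    by eventually_elim (auto intro: bound)
  from tendsto_le[OF _ lim_R lim_L this] show ?thesis by simp
qed

section \<open>Finite Blaschke products\<close>

text \<open>The Pick kernel of a single Blaschke factor has rank one: the last fraction is a
  function of z times its conjugate at w.\<close>

lemma one_minus_blaschke_factor:
  assumes "norm a < 1" "norm z < 1" "norm w < 1"
  shows "1 - (z - a) / (1 - cnj a * z) * cnj ((w - a) / (1 - cnj a * w)) =
    (1 - z * cnj w) * ((1 - a * cnj a) / ((1 - cnj a * z) * cnj (1 - cnj a * w)))"
proof -
  have "1 - cnj a * z \<noteq> 0" "cnj (1 - cnj a * w) \<noteq> 0"
    using assms szego_denominator[of a z] szego_denominator[of a w]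
    unfolding complex_cnj_zero_iff by auto
  then show ?thesis
    unfolding complex_cnj_divide times_divide_times_eq
    by (simp add: diff_divide_eq_iff) (simp add: algebra_simps)
qed

text \<open>The derivative is the square of the function that spans the rank one kernel of the
  factor. This is the source of the products \<open>e k z * g k z\<close>.\<close>

lemma blaschke_factor_deriv:
  assumes "norm a < 1" "norm z < 1"
  shows "((\<lambda>z. (z - a) / (1 - cnj a * z)) has_field_derivative (1 - a * cnj a) / (1 - cnj a * z)\<^sup>2) (at z)"
  using assms szego_denominator[of a z]
  by (auto intro!: derivative_eq_intros simp: algebra_simps power2_eq_square)

text \<open>The functions e k and g k are Takenaka-Malmquist bases of the model space of B, built from
  the zeros taken in increasing and in decreasing order.\<close>

lemma blaschke_kernel_decomposition:
  assumes a: "\<And>k. k < d \<Longrightarrow> norm (a k) < 1" and \<alpha>: "norm \<alpha> = 1"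
  defines "B \<equiv> \<lambda>m z. \<alpha> * (\<Prod>k<m. (z - a k) / (1 - cnj (a k) * z))"
  obtains e g :: "nat \<Rightarrow> complex \<Rightarrow> complex"
  where "\<And>z w. norm z < 1 \<Longrightarrow> norm w < 1 \<Longrightarrow>
      1 - B d z * cnj (B d w) = (1 - z * cnj w) * (\<Sum>k<d. e k z * cnj (e k w))"
    and "\<And>z w. norm z < 1 \<Longrightarrow> norm w < 1 \<Longrightarrow>
      1 - B d z * cnj (B d w) = (1 - z * cnj w) * (\<Sum>k<d. g k z * cnj (g k w))"
    and "\<And>z. norm z < 1 \<Longrightarrow> (B d has_field_derivative (\<Sum>k<d. e k z * g k z)) (at z)"
proof -
  define s where "s k = complex_of_real (sqrt (1 - (cmod (a k))\<^sup>2))" for k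
  have s: "s k * s k = 1 - a k * cnj (a k)" "cnj (s k) = s k" if "k < d" for k
  proof -
    have "(cmod (a k))\<^sup>2 \<le> 1" using a[OF that] by (simp add: power_le_one)
    then have "s k * s k = complex_of_real (1 - (cmod (a k))\<^sup>2)"
      by (simp add: s_def flip: of_real_mult)
    then show "s k * s k = 1 - a k * cnj (a k)"
      by (simp only: of_real_diff complex_norm_square of_real_1)
  qed (simp add: s_def)
  have "\<exists>e g. (\<forall>z w. norm z < 1 \<longrightarrow> norm w < 1 \<longrightarrow>
      1 - B m z * cnj (B m w) = (1 - z * cnj w) * (\<Sum>k<m. e k z * cnj (e k w)) \<and>
      1 - B m z * cnj (B m w) = (1 - z * cnj w) * (\<Sum>k<m. g k z * cnj (g k w))) \<and>
    (\<forall>z. norm z < 1 \<longrightarrow> (B m has_field_derivative (\<Sum>k<m. e k z * g k z)) (at z))"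
    if "m \<le> d" for m
    using that
  proof (induction m)
    case 0
    have "\<alpha> * cnj \<alpha> = 1"
      using \<alpha> by (simp flip: complex_norm_square)
    then show ?case by (simp add: B_def)
  next
    case (Suc m)
    have "m \<le> d" using Suc.prems by simp
    from Suc.IH[OF this] obtain e g :: "nat \<Rightarrow> complex \<Rightarrow> complex" where IH_all:
      "\<forall>z w. norm z < 1 \<longrightarrow> norm w < 1 \<longrightarrow>
        1 - B m z * cnj (B m w) = (1 - z * cnj w) * (\<Sum>k<m. e k z * cnj (e k w)) \<and>
        1 - B m z * cnj (B m w) = (1 - z * cnj w) * (\<Sum>k<m. g k z * cnj (g k w))"
      "\<forall>z. norm z < 1 \<longrightarrow> (B m has_field_derivative (\<Sum>k<m. e k z * g k z)) (at z)"
      by (elim exE conjE)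
    note IH = IH_all(1)[rule_format, THEN conjunct1] IH_all(1)[rule_format, THEN conjunct2]
      IH_all(2)[rule_format]
    have m: "m < d" "norm (a m) < 1" using Suc.prems a by auto
    define b where "b z = (z - a m) / (1 - cnj (a m) * z)" for z
    define t where "t z = s m / (1 - cnj (a m) * z)" for z
    \<comment> \<open>The two families come from splitting off the factor b in two ways: B b is
      reached from 1 either through B or through b. The products \<open>e' k z * g' k z\<close> are
      then the terms of the product rule, B' b for k < m and B b' for k = m.\<close>
    define e' where "e' k z = (if k < m then e k z else B m z * t z)" for k z
    define g' where "g' k z = (if k < m then g k z * b z else t z)" for k z
    have B_Suc: "B (Suc m) = (\<lambda>z. B m z * b z)"
      by (simp add: B_def b_def mult.assoc)
    have tt: "1 - b z * cnj (b w) = (1 - z * cnj w) * (t z * cnj (t w))"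
      if "norm z < 1" "norm w < 1" for z w
    proof -
      have "t z * cnj (t w) = (1 - a m * cnj (a m)) / ((1 - cnj (a m) * z) * cnj (1 - cnj (a m) * w))"
        unfolding t_def complex_cnj_divide s(2)[OF m(1)] times_divide_times_eq s(1)[OF m(1)] ..
      then show ?thesis
        unfolding b_def one_minus_blaschke_factor[OF m(2) that] by (simp only:)
    qed
    have "1 - B (Suc m) z * cnj (B (Suc m) w) =
        (1 - z * cnj w) * (\<Sum>k<Suc m. e' k z * cnj (e' k w))"
      "1 - B (Suc m) z * cnj (B (Suc m) w) =
        (1 - z * cnj w) * (\<Sum>k<Suc m. g' k z * cnj (g' k w))"
      if zw: "norm z < 1" "norm w < 1" for z w
    proof -
      have "1 - B (Suc m) z * cnj (B (Suc m) w) =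
          (1 - B m z * cnj (B m w)) + B m z * cnj (B m w) * (1 - b z * cnj (b w))"
        by (simp add: B_Suc algebra_simps)
      also have "\<dots> = (1 - z * cnj w) * (\<Sum>k<Suc m. e' k z * cnj (e' k w))"
        unfolding IH(1)[OF zw] tt[OF zw] by (simp add: e'_def algebra_simps)
      finally show "1 - B (Suc m) z * cnj (B (Suc m) w) =
        (1 - z * cnj w) * (\<Sum>k<Suc m. e' k z * cnj (e' k w))" .
      have "1 - B (Suc m) z * cnj (B (Suc m) w) =
          (1 - B m z * cnj (B m w)) * (b z * cnj (b w)) + (1 - b z * cnj (b w))"
        by (simp add: B_Suc algebra_simps)
      also have "(1 - B m z * cnj (B m w)) * (b z * cnj (b w)) =
          (1 - z * cnj w) * (\<Sum>k<m. g' k z * cnj (g' k w))"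
        unfolding IH(2)[OF zw] mult.assoc sum_distrib_right by (simp add: g'_def mult_ac)
      also have "1 - b z * cnj (b w) = (1 - z * cnj w) * (g' m z * cnj (g' m w))"
        unfolding tt[OF zw] by (simp add: g'_def)
      finally show "1 - B (Suc m) z * cnj (B (Suc m) w) =
        (1 - z * cnj w) * (\<Sum>k<Suc m. g' k z * cnj (g' k w))"
        by (simp add: distrib_left)
    qed
    moreover have "(B (Suc m) has_field_derivative (\<Sum>k<Suc m. e' k z * g' k z)) (at z)"
      if z: "norm z < 1" for z
    proof -
      have "(b has_field_derivative t z * t z) (at z)"
        using blaschke_factor_deriv[OF m(2) z] s(1)[OF m(1)]
        by (simp add: b_def[abs_def] t_def power2_eq_square)
      from DERIV_mult[OF IH(3)[OF z] this] show ?thesis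
        unfolding B_Suc by (simp add: e'_def g'_def sum_distrib_left mult_ac)
    qed
    ultimately show ?case by blast
  qed
  from this[OF order_refl] that show ?thesis by blast
qed

lemma finite_blaschke_imp_holomorphic_self_map:
  assumes "finite_blaschke d B" "d \<ge> 1"
  shows "B holomorphic_on unit_disc" "B ` unit_disc \<subseteq> unit_disc"
proof -
  obtain \<theta> a where "\<forall>k<d. a k \<in> unit_disc"
    and B: "\<forall>z\<in>unit_disc.
      B z = exp (\<i> * of_real \<theta>) * (\<Prod>k<d. (z - a k) / (1 - cnj (a k) * z))"
    using assms(1) unfolding finite_blaschke_def by blast
  then have a: "norm (a k) < 1" if "k < d" for k
    using that by simp
  have "(\<lambda>z. exp (\<i> * of_real \<theta>) * (\<Prod>k<d. (z - a k) / (1 - cnj (a k) * z))) holomorphic_on unit_disc"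
    using szego_denominator a
    by (intro holomorphic_intros) (auto simp: less_imp_le)
  then show "B holomorphic_on unit_disc"
    using B by (metis (no_types, lifting) holomorphic_cong)
  \<comment> \<open>The induction starts with one factor, since the empty product has modulus
    1.\<close>
  have "norm (\<Prod>k<m. (z - a k) / (1 - cnj (a k) * z)) < 1" if "norm z < 1" "1 \<le> m" "m \<le> d" for z m
    using that(2,3)
  proof (induction m rule: dec_induct)
    case base
    then show ?case
      using Moebius_function_norm_lt_1[OF a that(1), of 0 0] by (simp add: Moebius_function_simple)
  next
    case (step m)
    have "norm ((z - a m) / (1 - cnj (a m) * z)) < 1"
      using Moebius_function_norm_lt_1[OF a that(1), of m 0] step.prems
      by (simp add: Moebius_function_simple)
    with step have "norm (\<Prod>k<m. (z - a k) / (1 - cnj (a k) * z)) *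
        norm ((z - a m) / (1 - cnj (a m) * z)) < 1 * 1"
      by (intro mult_strict_mono') auto
    then show ?case
      by (simp only: prod.lessThan_Suc norm_mult mult_1)
  qed
  then show "B ` unit_disc \<subseteq> unit_disc"
    using B assms(2) by (auto simp: norm_mult)
qed

text \<open>The sum on the left is the trace of the d by d matrix F below, and the form of the
  squared kernel is its squared Hilbert-Schmidt norm. The factor d is the Cauchy-Schwarz constant
  between the two.\<close>

lemma blaschke_diagonal_bound:
  assumes "finite_blaschke d B" and Z: "\<And>i. i < n \<Longrightarrow> norm (Z i) < 1"
  shows "(cmod (\<Sum>i<n. c i * deriv B (Z i)))\<^sup>2 \<le>
    real d * Re (\<Sum>i<n. \<Sum>j<n. cnj (c i) * (pick_kernel B (Z j) (Z i))\<^sup>2 * c j)"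
proof -
  obtain \<theta> a where "\<forall>k<d. a k \<in> unit_disc"
    and B: "\<forall>z\<in>unit_disc.
      B z = exp (\<i> * of_real \<theta>) * (\<Prod>k<d. (z - a k) / (1 - cnj (a k) * z))"
    using assms(1) unfolding finite_blaschke_def by blast
  then have a: "norm (a k) < 1" if "k < d" for k
    using that by simp
  have \<alpha>: "norm (exp (\<i> * complex_of_real \<theta>)) = 1" by simp
  obtain e g :: "nat \<Rightarrow> complex \<Rightarrow> complex" where
    e0: "\<And>z w. norm z < 1 \<Longrightarrow> norm w < 1 \<Longrightarrow>
      1 - B z * cnj (B w) = (1 - z * cnj w) * (\<Sum>k<d. e k z * cnj (e k w))"
    and g0: "\<And>z w. norm z < 1 \<Longrightarrow> norm w < 1 \<Longrightarrow>
      1 - B z * cnj (B w) = (1 - z * cnj w) * (\<Sum>k<d. g k z * cnj (g k w))"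
    and deriv0: "\<And>z. norm z < 1 \<Longrightarrow>
      ((\<lambda>z. exp (\<i> * of_real \<theta>) * (\<Prod>k<d. (z - a k) / (1 - cnj (a k) * z)))
        has_field_derivative (\<Sum>k<d. e k z * g k z)) (at z)"
    using blaschke_kernel_decomposition[of d a, OF a \<alpha>] B
    by (smt (verit, ccfv_threshold) mem_ball_0)
  have deriv: "deriv B z = (\<Sum>k<d. e k z * g k z)" if "norm z < 1" for z
  proof -
    have "(B has_field_derivative (\<Sum>k<d. e k z * g k z)) (at z)"
      using deriv0[OF that] open_ball[of 0 1]
      by (rule has_field_derivative_transform_within_open) (use that B in auto)
    then show ?thesis by (rule DERIV_imp_deriv)
  qed
  have kernel: "pick_kernel B z w = (\<Sum>k<d. e k z * cnj (e k w))"
    "pick_kernel B z w = (\<Sum>k<d. g k z * cnj (g k w))" if "norm z < 1" "norm w < 1" for z w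
  proof -
    have "1 - z * cnj w \<noteq> 0"
      using szego_denominator[of w z] that by (simp add: mult.commute)
    then show "pick_kernel B z w = (\<Sum>k<d. e k z * cnj (e k w))"
      "pick_kernel B z w = (\<Sum>k<d. g k z * cnj (g k w))"
      using e0[OF that] g0[OF that] by (simp_all add: pick_kernel_def)
  qed
  define F where "F k l = (\<Sum>i<n. c i * (e k (Z i) * g l (Z i)))" for k l
  have "(\<Sum>i<n. c i * deriv B (Z i)) = (\<Sum>k<d. F k k)"
    unfolding F_def by (subst sum.swap) (simp add: Z deriv sum_distrib_left)
  then have "(cmod (\<Sum>i<n. c i * deriv B (Z i)))\<^sup>2 \<le> (\<Sum>k<d. cmod (F k k))\<^sup>2"
    by (simp add: norm_sum power_mono)
  also have "\<dots> \<le> real d * (\<Sum>k<d. (cmod (F k k))\<^sup>2)"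
    using sum_squared_le_sum_of_squares[of "\<lambda>k. cmod (F k k)" "{..<d}"] by (simp add: mult.commute)
  also have "\<dots> \<le> real d * (\<Sum>k<d. \<Sum>l<d. (cmod (F k l))\<^sup>2)"
    by (intro mult_left_mono sum_mono member_le_sum) auto
  finally have "(cmod (\<Sum>i<n. c i * deriv B (Z i)))\<^sup>2 \<le>
      real d * (\<Sum>k<d. \<Sum>l<d. (cmod (F k l))\<^sup>2)" .
  \<comment> \<open>One factor of the squared kernel is expanded in the functions e and the other in
    the functions g.\<close>
  moreover have "complex_of_real (\<Sum>k<d. \<Sum>l<d. (cmod (F k l))\<^sup>2) =
      (\<Sum>i<n. \<Sum>j<n. cnj (c i) * (pick_kernel B (Z j) (Z i))\<^sup>2 * c j)"
  proof -
    have "complex_of_real (\<Sum>k<d. \<Sum>l<d. (cmod (F k l))\<^sup>2) =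
        (\<Sum>k<d. \<Sum>l<d. \<Sum>j<n. \<Sum>i<n. c j * cnj (c i) *
          ((e k (Z j) * cnj (e k (Z i))) * (g l (Z j) * cnj (g l (Z i)))))"
      unfolding of_real_sum complex_norm_square F_def cnj_sum sum_product
      by (simp add: mult_ac)
    also have "\<dots> = (\<Sum>k<d. \<Sum>j<n. \<Sum>i<n. \<Sum>l<d. c j * cnj (c i) *
          ((e k (Z j) * cnj (e k (Z i))) * (g l (Z j) * cnj (g l (Z i)))))"
      by (rule sum.cong[OF refl], subst sum.swap, rule sum.cong[OF refl], rule sum.swap)
    also have "\<dots> = (\<Sum>j<n. \<Sum>i<n. \<Sum>k<d. \<Sum>l<d. c j * cnj (c i) *
          ((e k (Z j) * cnj (e k (Z i))) * (g l (Z j) * cnj (g l (Z i)))))"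
      by (subst sum.swap, rule sum.cong[OF refl], rule sum.swap)
    also have "\<dots> = (\<Sum>j<n. \<Sum>i<n. c j * cnj (c i) * (pick_kernel B (Z j) (Z i))\<^sup>2)"
    proof (intro sum.cong refl)
      fix j i assume "j \<in> {..<n}" "i \<in> {..<n}"
      then have ji: "norm (Z j) < 1" "norm (Z i) < 1" using Z by auto
      have "(pick_kernel B (Z j) (Z i))\<^sup>2 = (\<Sum>k<d. \<Sum>l<d.
          (e k (Z j) * cnj (e k (Z i))) * (g l (Z j) * cnj (g l (Z i))))"
        unfolding power2_eq_square sum_product[symmetric]
        using kernel[OF ji] by simp
      then show "(\<Sum>k<d. \<Sum>l<d. c j * cnj (c i) *
          ((e k (Z j) * cnj (e k (Z i))) * (g l (Z j) * cnj (g l (Z i))))) =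
          c j * cnj (c i) * (pick_kernel B (Z j) (Z i))\<^sup>2"
        by (simp only: sum_distrib_left)
    qed
    also have "\<dots> = (\<Sum>i<n. \<Sum>j<n. cnj (c i) * (pick_kernel B (Z j) (Z i))\<^sup>2 * c j)"
      by (subst sum.swap) (simp add: mult_ac)
    finally show ?thesis .
  qed
  then have "(\<Sum>k<d. \<Sum>l<d. (cmod (F k l))\<^sup>2) =
      Re (\<Sum>i<n. \<Sum>j<n. cnj (c i) * (pick_kernel B (Z j) (Z i))\<^sup>2 * c j)"
    by (metis Re_complex_of_real)
  ultimately show ?thesis by (simp only:)
qed

section \<open>Sharpness\<close>

lemma finite_blaschke_power: "finite_blaschke d (\<lambda>z. z ^ d)"
  unfolding finite_blaschke_def
  by (rule exI[of _ 0], rule exI[of _ "\<lambda>_. 0"]) simp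

text \<open>Equality is approached by z ^ d at m points r * w ^ i with w a primitive d-th root of unity:
  as r tends to 1, the matrix G becomes diagonal after scaling, whereas H is of rank one
  because z ^ d takes the same value at all these points.\<close>

lemma power_sharpness:
  fixes C :: real
  assumes m: "1 \<le> m" "m \<le> n" "m \<le> d"
    and le: "\<And>Z. (\<And>i. i < n \<Longrightarrow> Z i \<in> unit_disc) \<Longrightarrow>
      H_mat n (\<lambda>z. z ^ d) Z \<le>\<^sub>L of_real C \<cdot>\<^sub>m G_mat n Z"
  shows "real m \<le> C"
proof -
  have "d > 0" using m by simp
  define w where "w i = cis (2 * pi * real i / real d)" for i
  have w_power: "w i ^ d = 1" for i
  proof -
    have "real d * (2 * pi * real i / real d) = 2 * pi * real i"
      using \<open>d > 0\<close> by simp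
    then show ?thesis
      unfolding w_def Complex.DeMoivre by (simp only: cis_multiple_2pi Ints_of_nat)
  qed
  have w_norm: "w i * cnj (w i) = 1" for i
    by (simp add: w_def cis_cnj cis_mult)
  have w_inj: "i = j" if "w i = w j" "i < d" "j < d" for i j
    using Complex.bij_betw_roots_unity[OF \<open>d > 0\<close>] that by (auto simp: bij_betw_def inj_on_def w_def)
  \<comment> \<open>These phases cancel those of the derivatives of \<open>z ^ d\<close>, so all m
    contributions to the form of H add up. Only m indices are used, and m \<le> d makes the
    corresponding roots of unity distinct.\<close>
  define v where "v i = (if i < m then w i ^ (d - 1) else 0)" for i
  \<comment> \<open>The square of q is (1 - r^2)^2 times the form of H at v. The geometric sum
    replaces (1 - r^(2d)) / (1 - r^2), so that the limit at r = 1 is not of the form 0 / 0.\<close>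
  define q where "q r = real m * (real d * r ^ (d - 1) / (\<Sum>k<d. (r\<^sup>2) ^ k))" for r
  define \<Gamma> where "\<Gamma> r = (\<Sum>i<n. \<Sum>j<n. cnj (v i) * v j *
    (of_real (1 - r\<^sup>2) / (1 - of_real (r\<^sup>2) * (w i * cnj (w j))))\<^sup>2)" for r
  have ineq: "(q r)\<^sup>2 \<le> C * Re (\<Gamma> r)" if r: "0 < r" "r < 1" for r
  proof -
    define Z where "Z i = of_real r * w i" for i
    have Z: "Z i \<in> unit_disc" for i
      using r by (simp add: Z_def w_def norm_mult)
    have Z_power: "Z i ^ d = of_real (r ^ d)" for i
      by (simp add: Z_def power_mult_distrib w_power)
    define h where "h i j = deriv (\<lambda>z. z ^ d) (Z i) * cnj (deriv (\<lambda>z. z ^ d) (Z j)) /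
      (1 - Z i ^ d * cnj (Z j ^ d))\<^sup>2" for i j
    define g where "g i j = of_real C * (1 / (1 - Z i * cnj (Z j))\<^sup>2)" for i j
    have mats: "H_mat n (\<lambda>z. z ^ d) Z = mat n n (\<lambda>(i, j). h i j)"
      "of_real C \<cdot>\<^sub>m G_mat n Z = mat n n (\<lambda>(i, j). g i j)"
      by (auto simp: H_mat_def G_mat_def h_def g_def)
    have herm: "h j i = cnj (h i j)" "g j i = cnj (g i j)" for i j
      by (simp_all add: g_def h_def mult.commute)
    have "0 \<le> Re (sesq n (\<lambda>i j. g i j - h i j) v v)"
      using le[of Z] Z unfolding mats loewner_le_mat_iff[of n h g, OF herm] by blast
    also have "sesq n (\<lambda>i j. g i j - h i j) v v = sesq n g v v - sesq n h v v"
      by (simp add: sesq_def algebra_simps sum_subtractf)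
    finally have "Re (sesq n h v v) \<le> Re (sesq n g v v)" by simp
    then have "(1 - r\<^sup>2)\<^sup>2 * Re (sesq n h v v) \<le> (1 - r\<^sup>2)\<^sup>2 * Re (sesq n g v v)"
      by (rule mult_left_mono) simp
    moreover have "(1 - r\<^sup>2)\<^sup>2 * Re (sesq n g v v) = C * Re (\<Gamma> r)"
    proof -
      have "of_real ((1 - r\<^sup>2)\<^sup>2) * sesq n g v v = of_real C * \<Gamma> r"
        unfolding sesq_def \<Gamma>_def sum_distrib_left
        by (intro sum.cong refl)
          (simp add: g_def Z_def power_divide power2_eq_square mult_ac)
      from arg_cong[OF this, of Re] show ?thesis by simp
    qed
    moreover have "(1 - r\<^sup>2)\<^sup>2 * Re (sesq n h v v) = (q r)\<^sup>2"
    proof -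
      have d1: "deriv (\<lambda>z. z ^ d) z = of_nat d * z ^ (d - 1)" for z :: complex
        by (rule DERIV_imp_deriv) (auto intro!: derivative_eq_intros)
      define s where "s = of_nat d * complex_of_real r ^ (d - 1)"
      have entry: "cnj (v i) * h i j * v j =
          (if i < m then s else 0) * (if j < m then s else 0) / of_real ((1 - r ^ d * r ^ d)\<^sup>2)" for i j
      proof -
        have unit: "cnj (w i) ^ (d - 1) * w i ^ (d - 1) = 1" for i
          by (simp add: mult.commute w_norm flip: power_mult_distrib)
        have "cnj (w i ^ (d - 1)) * (s * w i ^ (d - 1) * cnj (s * w j ^ (d - 1))) * w j ^ (d - 1) =
            s * s * (cnj (w i) ^ (d - 1) * w i ^ (d - 1)) * (cnj (w j) ^ (d - 1) * w j ^ (d - 1))"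
          by (simp add: s_def mult_ac)
        then have *: "cnj (w i ^ (d - 1)) * (s * w i ^ (d - 1) * cnj (s * w j ^ (d - 1))) *
            w j ^ (d - 1) = s * s"
          unfolding unit by simp
        have "deriv (\<lambda>z. z ^ d) (Z i) = s * w i ^ (d - 1)" for i
          by (simp add: d1 Z_def s_def power_mult_distrib)
        then have "h i j = s * w i ^ (d - 1) * cnj (s * w j ^ (d - 1)) / of_real ((1 - r ^ d * r ^ d)\<^sup>2)"
          unfolding h_def Z_power by simp
        then show ?thesis
          using * by (simp add: v_def del: complex_cnj_mult complex_cnj_power)
      qed
      have "sesq n h v v = (\<Sum>i<n. if i < m then s else 0) * (\<Sum>j<n. if j < m then s else 0) /
          of_real ((1 - r ^ d * r ^ d)\<^sup>2)"
        unfolding sesq_def entry sum_product sum_divide_distrib ..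
      also have "(\<Sum>i<n. if i < m then s else 0) = of_nat m * s"
      proof -
        have "{..<n} \<inter> {i. i < m} = {..<m}" using m by auto
        then show ?thesis by (simp add: sum.If_cases)
      qed
      finally have "sesq n h v v = of_real ((real m * (real d * r ^ (d - 1)))\<^sup>2 / (1 - r ^ d * r ^ d)\<^sup>2)"
        by (simp add: s_def power2_eq_square)
      then have "Re (sesq n h v v) = (real m * (real d * r ^ (d - 1)))\<^sup>2 / (1 - r ^ d * r ^ d)\<^sup>2"
        by (simp only: Re_complex_of_real)
      moreover have "1 - r ^ d * r ^ d = (1 - r\<^sup>2) * (\<Sum>k<d. (r\<^sup>2) ^ k)"
        using one_diff_power_eq[of "r\<^sup>2" d]
        by (simp add: power_mult_distrib power2_eq_square)
      moreover have "1 - r\<^sup>2 \<noteq> 0"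
        using r by (simp add: power2_eq_1_iff)
      ultimately show ?thesis
        by (simp add: q_def power_mult_distrib power_divide)
    qed
    ultimately show ?thesis by simp
  qed
  have lim_entry: "((\<lambda>r. cnj (v i) * v j *
      (complex_of_real (1 - r\<^sup>2) / (1 - of_real (r\<^sup>2) * (w i * cnj (w j))))\<^sup>2) \<longlongrightarrow>
      (if i = j then if i < m then 1 else 0 else 0)) (at_left 1)" for i j
  proof (cases "i < m \<and> j < m")
    case False
    then show ?thesis by (auto simp: v_def)
  next
    case True
    show ?thesis
    proof (cases "i = j")
      case True
      \<comment> \<open>On the diagonal the quotient is 0 / 0 at r = 1, so the limit is read off
        from the constant value 1 for r < 1 instead of by continuity.\<close>
      have "eventually (\<lambda>r. r \<in> {0<..<1}) (at_left (1::real))"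
        by (rule eventually_at_left_real) simp
      then have "eventually (\<lambda>r. cnj (v i) * v j *
        (complex_of_real (1 - r\<^sup>2) / (1 - of_real (r\<^sup>2) * (w i * cnj (w j))))\<^sup>2 = 1) (at_left 1)"
      proof eventually_elim
        case (elim r)
        then have "complex_of_real (1 - r\<^sup>2) \<noteq> 0"
          unfolding of_real_eq_0_iff by (auto simp: power2_eq_1_iff)
        moreover have "cnj (v i) * v i = 1"
          using \<open>i < m \<and> j < m\<close> by (simp add: v_def w_norm mult.commute flip: power_mult_distrib)
        ultimately show ?case using True by (simp add: w_norm)
      qed
      then show ?thesis
        using True \<open>i < m \<and> j < m\<close> by (simp add: tendsto_eventually)
    next
      case False
      have "w i \<noteq> w j"
        using w_inj[of i j] False \<open>i < m \<and> j < m\<close> m by auto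
      then have "w i * cnj (w j) \<noteq> 1"
        by (metis mult.assoc mult.commute mult_1 w_norm)
      then have "((\<lambda>r. cnj (v i) * v j *
        (complex_of_real (1 - r\<^sup>2) / (1 - of_real (r\<^sup>2) * (w i * cnj (w j))))\<^sup>2) \<longlongrightarrow>
        cnj (v i) * v j * (complex_of_real (1 - 1\<^sup>2) / (1 - of_real (1\<^sup>2) * (w i * cnj (w j))))\<^sup>2)
        (at_left 1)"
        by (intro tendsto_intros) auto
      then show ?thesis using False by simp
    qed
  qed
  have "(\<Gamma> \<longlongrightarrow> (\<Sum>i<n. \<Sum>j<n. if i = j then if i < m then 1 else 0 else 0)) (at_left 1)"
    unfolding \<Gamma>_def by (intro tendsto_sum lim_entry)
  also have "(\<Sum>i<n. \<Sum>j<n. if i = j then if i < m then 1 else 0 else 0) = complex_of_nat m"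
  proof -
    have "{..<n} \<inter> {i. i < m} = {..<m}" using m by auto
    then show ?thesis by (simp add: sum.If_cases)
  qed
  finally have "((\<lambda>r. C * Re (\<Gamma> r)) \<longlongrightarrow> C * Re (complex_of_nat m)) (at_left 1)"
    by (intro tendsto_intros)
  then have lim_\<Gamma>: "((\<lambda>r. C * Re (\<Gamma> r)) \<longlongrightarrow> C * real m) (at_left 1)"
    by simp
  have "((\<lambda>r. (q r)\<^sup>2) \<longlongrightarrow> (real m * (real d * 1 ^ (d - 1) / (\<Sum>k<d. (1\<^sup>2) ^ k)))\<^sup>2) (at_left 1)"
    unfolding q_def using \<open>d > 0\<close> by (intro tendsto_intros) auto
  then have lim_q: "((\<lambda>r. (q r)\<^sup>2) \<longlongrightarrow> (real m)\<^sup>2) (at_left 1)"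
    using \<open>d > 0\<close> by simp
  have "eventually (\<lambda>r. r \<in> {0<..<1}) (at_left (1::real))"
    by (rule eventually_at_left_real) simp
  then have "eventually (\<lambda>r. (q r)\<^sup>2 \<le> C * Re (\<Gamma> r)) (at_left 1)"
    by eventually_elim (auto intro: ineq)
  \<comment> \<open>In the limit the form of H at v gives m^2, whereas the scaled G becomes the
    identity on the first m coordinates and gives m.\<close>
  from tendsto_le[OF _ lim_\<Gamma> lim_q this] have "real m * real m \<le> C * real m"
    by (simp add: power2_eq_square)
  then show ?thesis using m by simp
qed

theorem theorem2p1:
  fixes n :: nat
  assumes "n \<ge> 1"
  shows "(\<forall>(f :: complex \<Rightarrow> complex) (Z :: nat \<Rightarrow> complex).
            f holomorphic_on unit_disc \<longrightarrow> f ` unit_disc \<subseteq> unit_disc \<longrightarrow>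
            (\<forall>i<n. Z i \<in> unit_disc) \<longrightarrow>
            H_mat n f Z \<le>\<^sub>L of_nat n \<cdot>\<^sub>m G_mat n Z)
       \<and> (\<forall>(d :: nat) (B :: complex \<Rightarrow> complex) (Z :: nat \<Rightarrow> complex).
            d \<ge> 1 \<longrightarrow> finite_blaschke d B \<longrightarrow> (\<forall>i<n. Z i \<in> unit_disc) \<longrightarrow>
            H_mat n B Z \<le>\<^sub>L of_nat (min n d) \<cdot>\<^sub>m G_mat n Z)
       \<and> \<not> (\<exists>C :: real. C < real n \<and>
            (\<forall>(f :: complex \<Rightarrow> complex) (Z :: nat \<Rightarrow> complex).
               f holomorphic_on unit_disc \<longrightarrow> f ` unit_disc \<subseteq> unit_disc \<longrightarrow>
               (\<forall>i<n. Z i \<in> unit_disc) \<longrightarrow>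
               H_mat n f Z \<le>\<^sub>L of_real C \<cdot>\<^sub>m G_mat n Z))
       \<and> (\<forall>d :: nat. d \<ge> 1 \<longrightarrow>
            \<not> (\<exists>C :: real. C < real (min n d) \<and>
               (\<forall>(B :: complex \<Rightarrow> complex) (Z :: nat \<Rightarrow> complex).
                  finite_blaschke d B \<longrightarrow> (\<forall>i<n. Z i \<in> unit_disc) \<longrightarrow>
                  H_mat n B Z \<le>\<^sub>L of_real C \<cdot>\<^sub>m G_mat n Z)))"
proof (intro conjI allI impI)
  fix f :: "complex \<Rightarrow> complex" and Z :: "nat \<Rightarrow> complex"
  assume f: "f holomorphic_on unit_disc" "f ` unit_disc \<subseteq> unit_disc"
    and "\<forall>i<n. Z i \<in> unit_disc"
  then have Z: "norm (Z i) < 1" "norm (f (Z i)) < 1" if "i < n" for i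
    using that by (auto simp: image_subset_iff)
  show "H_mat n f Z \<le>\<^sub>L of_nat n \<cdot>\<^sub>m G_mat n Z"
    using H_mat_le_G_mat[of n Z f "real n", OF Z self_map_diagonal_bound[OF f Z(1)]] by simp
next
  fix d :: nat and B :: "complex \<Rightarrow> complex" and Z :: "nat \<Rightarrow> complex"
  assume B: "d \<ge> 1" "finite_blaschke d B" and "\<forall>i<n. Z i \<in> unit_disc"
  note self_map = finite_blaschke_imp_holomorphic_self_map[OF B(2,1)]
  have Z: "norm (Z i) < 1" "norm (B (Z i)) < 1" if "i < n" for i
    using that self_map(2) \<open>\<forall>i<n. Z i \<in> unit_disc\<close> by (auto simp: image_subset_iff)
  have "H_mat n B Z \<le>\<^sub>L of_real (real n) \<cdot>\<^sub>m G_mat n Z"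
    using Z self_map_diagonal_bound[OF self_map Z(1)] by (rule H_mat_le_G_mat)
  moreover have "H_mat n B Z \<le>\<^sub>L of_real (real d) \<cdot>\<^sub>m G_mat n Z"
    using Z blaschke_diagonal_bound[OF B(2) Z(1)] by (rule H_mat_le_G_mat)
  ultimately show "H_mat n B Z \<le>\<^sub>L of_nat (min n d) \<cdot>\<^sub>m G_mat n Z"
    by (simp add: min_def)
next
  show "\<not> (\<exists>C :: real. C < real n \<and>
      (\<forall>(f :: complex \<Rightarrow> complex) (Z :: nat \<Rightarrow> complex).
         f holomorphic_on unit_disc \<longrightarrow> f ` unit_disc \<subseteq> unit_disc \<longrightarrow>
         (\<forall>i<n. Z i \<in> unit_disc) \<longrightarrow>
         H_mat n f Z \<le>\<^sub>L of_real C \<cdot>\<^sub>m G_mat n Z))"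
  proof
    assume "\<exists>C :: real. C < real n \<and>
      (\<forall>(f :: complex \<Rightarrow> complex) (Z :: nat \<Rightarrow> complex).
         f holomorphic_on unit_disc \<longrightarrow> f ` unit_disc \<subseteq> unit_disc \<longrightarrow>
         (\<forall>i<n. Z i \<in> unit_disc) \<longrightarrow>
         H_mat n f Z \<le>\<^sub>L of_real C \<cdot>\<^sub>m G_mat n Z)"
    then obtain C :: real where C: "C < real n"
      and le: "\<And>f Z. f holomorphic_on unit_disc \<Longrightarrow> f ` unit_disc \<subseteq> unit_disc \<Longrightarrow>
        (\<And>i. i < n \<Longrightarrow> Z i \<in> unit_disc) \<Longrightarrow>
        H_mat n f Z \<le>\<^sub>L of_real C \<cdot>\<^sub>m G_mat n Z"
      by blast
    \<comment> \<open>The power \<open>z ^ n\<close>, itself a Blaschke product, already shows the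
      constant n to be optimal: take m = d = n.\<close>
    have "real n \<le> C"
      using assms order_refl order_refl
        le[OF finite_blaschke_imp_holomorphic_self_map[OF finite_blaschke_power assms]]
      by (rule power_sharpness)
    with C show False by simp
  qed
next
  fix d :: nat
  assume d: "d \<ge> 1"
  show "\<not> (\<exists>C :: real. C < real (min n d) \<and>
      (\<forall>(B :: complex \<Rightarrow> complex) (Z :: nat \<Rightarrow> complex).
         finite_blaschke d B \<longrightarrow> (\<forall>i<n. Z i \<in> unit_disc) \<longrightarrow>
         H_mat n B Z \<le>\<^sub>L of_real C \<cdot>\<^sub>m G_mat n Z))"
  proof
    assume "\<exists>C :: real. C < real (min n d) \<and>
      (\<forall>(B :: complex \<Rightarrow> complex) (Z :: nat \<Rightarrow> complex).
         finite_blaschke d B \<longrightarrow> (\<forall>i<n. Z i \<in> unit_disc) \<longrightarrow>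
         H_mat n B Z \<le>\<^sub>L of_real C \<cdot>\<^sub>m G_mat n Z)"
    then obtain C :: real where C: "C < real (min n d)"
      and le: "\<And>B Z. finite_blaschke d B \<Longrightarrow> (\<And>i. i < n \<Longrightarrow> Z i \<in> unit_disc) \<Longrightarrow>
        H_mat n B Z \<le>\<^sub>L of_real C \<cdot>\<^sub>m G_mat n Z"
      by blast
    have "1 \<le> min n d" using assms d by simp
    then have "real (min n d) \<le> C"
      using min.cobounded1 min.cobounded2 le[OF finite_blaschke_power] by (rule power_sharpness)
    with C show False by simp
  qed
qed

end
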